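(* Let $\beta_{1\star}\in\mathbf R^{d_1}\setminus\{0\}$, $\beta_{2\star}\in\mathbf R^{d_2}\setminus\{0\}$, $M_\star=\beta_{1\star}\beta_{2\star}^\top$, and $y=x_1^\top M_\star x_2+\varepsilon$, where $x_1\sim\mathsf D_{x_1}\in\mathcal P_4(\mathbf R^{d_1})$ and $x_2\sim\mathsf D_{x_2}\in\mathcal P_4(\mathbf R^{d_2})$ are independent and $\varepsilon$ is independent of $(x_1,x_2)$ with zero mean and finite variance; let $\mathsf D$ be the joint law of $(x_1,x_2,y)$. Consider the bilinear sensing problem $$\min_{M\in\mathbf R^{d_1\times d_2}:\ \mathrm{rank}(M)=1}\ \mathbb E_{(x_1,x_2,y)\sim\mathsf D}\tfrac12\big(x_1^\top Mx_2-y\big)^2,$$ and set $\Sigma_1=\mathbb E[x_1x_1^\top]$, $\Sigma_2=\mathbb E[x_2x_2^\top]$. Then $$\mathrm{RSE}(\mathsf D)=\min\Big\{\sqrt{\lambda_{\min}(\Sigma_1)},\sqrt{\lambda_{\min}(\Sigma_2)}\Big\}.$$ In particular, if $\mathsf D_{x_1}\times\mathsf D_{x_2}\in\mathcal Q\setminus\mathcal E$, then $$\frac{\min\{\lambda_{\min}(\Sigma_1),\lambda_{\min}(\Sigma_2)\}}{\min\{\gamma_2\lambda_{\min}(\Sigma_1),\gamma_1\lambda_{\min}(\Sigma_2)\}}\le\mathrm{RSE}(\mathsf D)^2\cdot\mathrm{REG}(\mathsf D)\le C\cdot\frac{\min\{\lambda_{\min}(\Sigma_1),\lambda_{\min}(\Sigma_2)\}}{\min\{\gamma_2\lambda_{\min}(\Sigma_1),\gamma_1\lambda_{\min}(\Sigma_2)\}},$$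 where $\gamma_i=\Big\langle\Sigma_i\frac{\beta_{i\star}}{\|\beta_{i\star}\|_2},\frac{\beta_{i\star}}{\|\beta_{i\star}\|_2}\Big\rangle$ for $i=1,2$ and $C=\frac{\kappa(\Sigma_1)\kappa(\Sigma_2)+1}{2}$.
   Context: $\kappa(\Sigma)=\lambda_{\max}(\Sigma)/\lambda_{\min}(\Sigma)$. $\mathcal P_4(\mathbf R^m)$ is the set of Borel probability measures on $\mathbf R^m$ with finite fourth moment; the permissible set of feature distributions is $\mathcal Q=\mathcal P_4(\mathbf R^{d_1})\times\mathcal P_4(\mathbf R^{d_2})$, i.e. product measures $\mu\times\nu$ on $\mathbf R^{d_1}\times\mathbf R^{d_2}$. $W_2(\mu,\nu)=\min_{\pi\in\Pi(\mu,\nu)}(\mathbb E_{(x,x')\sim\pi}\|x-x'\|_2^2)^{1/2}$ over couplings (here on the Euclidean space $\mathbf R^{d_1}\times\mathbf R^{d_2}$), $W_2(\mu,\mathcal E)=\inf_{\nu\in\mathcal E}W_2(\mu,\nu)$. $\mathbf R^{d_1\times d_2}$ carries the trace inner product. Tilt-stability and REG: for a $C^2$ embedded submanifold $\mathcal M$ of a Euclidean space and $C^2$-smooth $f$ on $\mathcal M$, a minimizer $\theta_\star$ of $f$ over $\mathcal M$ is tilt-stable if for some $\epsilon>0$ the map $\sigma(V)=\operatorname{argmin}_{\theta\in\mathcal M\cap B_\epsilon(\theta_\star)}\{f(\theta)-\langle V,\theta\rangle\}$ satisfies $\sigma(0)=\theta_\star$ and is single-valued and $C^1$-smooth on a neighborhood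 of the origin; then $\mathrm{REG}=\|\nabla\sigma(0)\|_{\rm op}$; otherwise $\mathrm{REG}=+\infty$. $\mathrm{REG}(\mathsf D)$ is this quantity for the displayed problem at $M_\star$. RSE (supervised): $\mathcal E$ is the set of $\mu\times\nu\in\mathcal Q$ for which $M_\star$ is not a tilt-stable minimizer of the problem in which $(x_1,x_2)\sim\mu\times\nu$ and the conditional law of $y$ given $(x_1,x_2)$ is unchanged; $\mathrm{RSE}(\mathsf D)=W_2(\mathsf D_{x_1}\times\mathsf D_{x_2},\mathcal E)$. *)

theory Defs
  imports "HOL-Probability.Probability"
begin

definition eigenvalues :: "real ^ 'n ^ 'n \<Rightarrow> real set" where
  "eigenvalues A = {c. \<exists>v. v \<noteq> 0 \<and> A *v v = c *\<^sub>R v}"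

definition lambda_min :: "real ^ 'n ^ 'n \<Rightarrow> real" where
  "lambda_min A = Min (eigenvalues A)"

definition lambda_max :: "real ^ 'n ^ 'n \<Rightarrow> real" where
  "lambda_max A = Max (eigenvalues A)"

definition cond_number :: "real ^ 'n ^ 'n \<Rightarrow> real" where
  "cond_number A = lambda_max A / lambda_min A"

definition outer_product :: "real ^ 'm \<Rightarrow> real ^ 'n \<Rightarrow> real ^ 'n ^ 'm" where
  "outer_product u v = (\<chi> i j. u $ i * v $ j)"

definition second_moment :: "(real ^ 'n) measure \<Rightarrow> real ^ 'n ^ 'n" where
  "second_moment \<mu> = (\<chi> i j. LINT x|\<mu>. x $ i * x $ j)"

text \<open>The library notion \<open>indep_var\<close> requires both variables to have the same
  codomain; this is what it unfolds to, with different codomains allowed.\<close>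

definition indep_rv ::
  "'w measure \<Rightarrow> ('w \<Rightarrow> 'a::topological_space) \<Rightarrow> ('w \<Rightarrow> 'b::topological_space) \<Rightarrow> bool" where
  "indep_rv P X Y \<longleftrightarrow>
     X \<in> borel_measurable P \<and> Y \<in> borel_measurable P \<and>
     prob_space.indep_set P {X -` A \<inter> space P | A. A \<in> sets borel}
                            {Y -` B \<inter> space P | B. B \<in> sets borel}"

definition P4 :: "'a::euclidean_space measure set" where
  "P4 = {\<mu>. prob_space \<mu> \<and> sets \<mu> = sets borel \<and> integrable \<mu> (\<lambda>x. norm x ^ 4)}"

definition permissible :: "('a::euclidean_space \<times> 'b::euclidean_space) measure set" where
  "permissible = {\<mu> \<Otimes>\<^sub>M \<nu> | \<mu> \<nu>. \<mu> \<in> P4 \<and> \<nu> \<in> P4}"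

definition couplings ::
  "'a::euclidean_space measure \<Rightarrow> 'a measure \<Rightarrow> ('a \<times> 'a) measure set" where
  "couplings \<mu> \<nu> = {\<pi>. prob_space \<pi> \<and> sets \<pi> = sets borel \<and>
                      distr \<pi> borel fst = \<mu> \<and> distr \<pi> borel snd = \<nu>}"

definition ennreal_sqrt :: "ennreal \<Rightarrow> ennreal" where
  "ennreal_sqrt a = (if a = \<infinity> then \<infinity> else ennreal (sqrt (enn2real a)))"

definition W2 :: "'a::euclidean_space measure \<Rightarrow> 'a measure \<Rightarrow> ennreal" where
  "W2 \<mu> \<nu> =
     (INF \<pi> \<in> couplings \<mu> \<nu>. ennreal_sqrt (\<integral>\<^sup>+ z. ennreal ((norm (fst z - snd z))\<^sup>2) \<partial>\<pi>))"

definition W2_set :: "'a::euclidean_space measure \<Rightarrow> 'a measure set \<Rightarrow> ennreal" where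
  "W2_set \<mu> E = (INF \<nu> \<in> E. W2 \<mu> \<nu>)"

definition C1_smooth_on ::
  "'a::euclidean_space set \<Rightarrow> ('a \<Rightarrow> 'b::euclidean_space) \<Rightarrow> bool" where
  "C1_smooth_on U g \<longleftrightarrow>
     (\<exists>g'. (\<forall>x\<in>U. (g has_derivative blinfun_apply (g' x)) (at x)) \<and> continuous_on U g')"

definition tilt_argmin ::
  "'a::euclidean_space set \<Rightarrow> ('a \<Rightarrow> real) \<Rightarrow> 'a \<Rightarrow> real \<Rightarrow> 'a \<Rightarrow> 'a set" where
  "tilt_argmin S f \<theta>\<^sub>0 \<epsilon> V =
     {\<theta>. is_arg_min (\<lambda>\<theta>. f \<theta> - V \<bullet> \<theta>) (\<lambda>\<theta>. \<theta> \<in> S \<inter> cball \<theta>\<^sub>0 \<epsilon>) \<theta>}"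

text \<open>The map \<open>\<sigma>\<close>; meaningful at those \<open>V\<close> where the set of minimizers is a singleton.\<close>

definition tilt_map ::
  "'a::euclidean_space set \<Rightarrow> ('a \<Rightarrow> real) \<Rightarrow> 'a \<Rightarrow> real \<Rightarrow> 'a \<Rightarrow> 'a" where
  "tilt_map S f \<theta>\<^sub>0 \<epsilon> V = the_elem (tilt_argmin S f \<theta>\<^sub>0 \<epsilon> V)"

definition tilt_stable_radius ::
  "'a::euclidean_space set \<Rightarrow> ('a \<Rightarrow> real) \<Rightarrow> 'a \<Rightarrow> real \<Rightarrow> bool" where
  "tilt_stable_radius S f \<theta>\<^sub>0 \<epsilon> \<longleftrightarrow>
     \<epsilon> > 0 \<and> tilt_argmin S f \<theta>\<^sub>0 \<epsilon> 0 = {\<theta>\<^sub>0} \<and>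
     (\<exists>U. open U \<and> 0 \<in> U \<and> (\<forall>V\<in>U. is_singleton (tilt_argmin S f \<theta>\<^sub>0 \<epsilon> V)) \<and>
          C1_smooth_on U (tilt_map S f \<theta>\<^sub>0 \<epsilon>))"

definition tilt_stable_minimizer ::
  "'a::euclidean_space set \<Rightarrow> ('a \<Rightarrow> real) \<Rightarrow> 'a \<Rightarrow> bool" where
  "tilt_stable_minimizer S f \<theta>\<^sub>0 \<longleftrightarrow>
     is_arg_min f (\<lambda>\<theta>. \<theta> \<in> S) \<theta>\<^sub>0 \<and> (\<exists>\<epsilon>. tilt_stable_radius S f \<theta>\<^sub>0 \<epsilon>)"

text \<open>The choice of the radius is immaterial: if two radii both qualify, continuity of \<open>\<sigma>\<close> at the
  origin makes the two maps agree near the origin.\<close>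

definition REG :: "'a::euclidean_space set \<Rightarrow> ('a \<Rightarrow> real) \<Rightarrow> 'a \<Rightarrow> ennreal" where
  "REG S f \<theta>\<^sub>0 =
     (if tilt_stable_minimizer S f \<theta>\<^sub>0
      then ennreal (onorm (frechet_derivative
             (tilt_map S f \<theta>\<^sub>0 (SOME \<epsilon>. tilt_stable_radius S f \<theta>\<^sub>0 \<epsilon>)) (at 0)))
      else \<infinity>)"

text \<open>Data are triples \<open>((x1, x2), y)\<close>. The inner product of \<open>real ^ 'n ^ 'm\<close> is the trace inner
  product, so its norm is the Frobenius norm.\<close>

definition rank_one_matrices :: "(real ^ 'n ^ 'm) set" where
  "rank_one_matrices = {M. rank M = 1}"

definition bilinear_risk ::
  "(((real ^ 'm) \<times> (real ^ 'n)) \<times> real) measure \<Rightarrow> real ^ 'n ^ 'm \<Rightarrow> real" where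
  "bilinear_risk D M = (LINT z|D. (case z of ((x1, x2), y) \<Rightarrow> (x1 \<bullet> (M *v x2) - y)\<^sup>2 / 2))"

text \<open>The joint law of \<open>(x, y)\<close> when \<open>x\<close> has law \<open>Q\<close> and \<open>K x\<close> is the conditional law of \<open>y\<close>
  given \<open>x\<close>.\<close>

definition joint_law ::
  "'a::euclidean_space measure \<Rightarrow> ('a \<Rightarrow> real measure) \<Rightarrow> ('a \<times> real) measure" where
  "joint_law Q K = Q \<bind> (\<lambda>x. distr (K x) borel (\<lambda>y. (x, y)))"

definition exceptional ::
  "((real ^ 'm) \<times> (real ^ 'n) \<Rightarrow> real measure) \<Rightarrow> real ^ 'n ^ 'm \<Rightarrow>
   ((real ^ 'm) \<times> (real ^ 'n)) measure set" where
  "exceptional K M = {Q \<in> permissible.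
     \<not> tilt_stable_minimizer rank_one_matrices (bilinear_risk (joint_law Q K)) M}"

definition law_x1 :: "(('a::euclidean_space \<times> 'b::euclidean_space) \<times> real) measure \<Rightarrow> 'a measure" where
  "law_x1 D = distr D borel (\<lambda>z. fst (fst z))"

definition law_x2 :: "(('a::euclidean_space \<times> 'b::euclidean_space) \<times> real) measure \<Rightarrow> 'b measure" where
  "law_x2 D = distr D borel (\<lambda>z. snd (fst z))"

text \<open>The conditional law \<open>K\<close> of \<open>y\<close> is an explicit argument: \<open>D\<close> determines it only almost
  everywhere with respect to the law of the features, whereas the exceptional set involves feature
  laws with arbitrary support.\<close>

definition RSE ::
  "(((real ^ 'm) \<times> (real ^ 'n)) \<times> real) measure \<Rightarrow> ((real ^ 'm) \<times> (real ^ 'n) \<Rightarrow> real measure) \<Rightarrow>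
   real ^ 'n ^ 'm \<Rightarrow> ennreal" where
  "RSE D K M = W2_set (law_x1 D \<Otimes>\<^sub>M law_x2 D) (exceptional K M)"

definition REG_bilinear ::
  "(((real ^ 'm) \<times> (real ^ 'n)) \<times> real) measure \<Rightarrow> real ^ 'n ^ 'm \<Rightarrow> ennreal" where
  "REG_bilinear D M = REG rank_one_matrices (bilinear_risk D) M"

end

theory Submission
  imports Defs
begin

text \<open>
  For independent features the risk is the constant plus half the quadratic form
  \<open>Q X = (\<Sigma>1 ** X ** \<Sigma>2) \<bullet> X\<close> at \<open>X = M - M\<^sub>0\<close>. If some \<open>\<Sigma>i\<close> is singular, then \<open>Q\<close> vanishes along a line
  through \<open>M\<^sub>0\<close> that stays in the rank-one matrices, so \<open>M\<^sub>0\<close> is not even an isolated minimizer. If both are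
  regular, \<open>Q\<close> is positive definite; the implicit function theorem, applied to the critical point
  equations in \<open>M = u v\<^sup>T\<close>, yields tilt stability, and the derivative \<open>L\<close> of the solution map is the
  inverse of the compression of \<open>Q\<close> to the tangent space \<open>{x \<beta>2\<^sup>T + \<beta>1 y\<^sup>T}\<close>. Testing on \<open>u \<beta>2\<^sup>T\<close> and
  \<open>\<beta>1 v\<^sup>T\<close> with minimal eigenvectors bounds the norm of \<open>L\<close> from below; splitting a tangent vector into
  orthogonal pieces of these two types costs at most the factor \<open>C\<close>, by Wielandt's inequality. Thus the
  exceptional laws are the products with a singular second moment. A coupling with such a law moves the
  features at least by their component along the kernel direction, and projecting out the minimal
  eigenvector of \<open>\<Sigma>i\<close> attains this bound.
\<close>

section \<open>Rank-one matrices and the implicit function theorem\<close>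

text \<open>Zero is a limit of rank-one matrices, so the feasible set is not closed; radii below the
  norm of the minimizer restore compactness. Nor is the set convex, so uniqueness of tilted
  minimizers does not follow from positive definiteness alone. Instead, positive definiteness on the
  whole matrix space keeps the minimizers for tilt V at a distance from \<open>M0\<close>
  proportional to |V|. They are therefore interior to the ball and critical, and the implicit
  function theorem leaves only one critical point there. The gradient of the risk vanishes at
  \<open>M0\<close> in the ambient space, so the curvature of the rank-one matrices does not enter
  L. The energy of x y^T factors as (S1 x . x) (S2 y . y). Hence the least Rayleigh quotients on the
  two types of tangent vectors are the two terms in the denominator of the theorem. The two types
  can be split orthogonally for the trace inner product but not for the energy, and C is the price:
  the form has condition number at most k = kappa(S1) kappa(S2), and averaging the energies of x + y
  and x - y gives (k + 1) / 2.\<close>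

lemma outer_product_nth [simp]: "outer_product u v $ i $ j = u $ i * v $ j"
  by (simp add: outer_product_def)

lemma bounded_bilinear_outer_product:
  "bounded_bilinear (outer_product :: real ^ 'm \<Rightarrow> real ^ 'n \<Rightarrow> real ^ 'n ^ 'm)"
  unfolding bilinear_conv_bounded_bilinear[symmetric] bilinear_def
  by (auto intro!: linearI simp: vec_eq_iff algebra_simps)

lemma bounded_bilinear_matrix_vector_mult:
  "bounded_bilinear ((*v) :: real ^ 'n ^ 'm \<Rightarrow> real ^ 'n \<Rightarrow> real ^ 'm)"
  unfolding bilinear_conv_bounded_bilinear[symmetric] bilinear_def
  by (auto intro!: linearI simp: vec_eq_iff matrix_vector_mult_def algebra_simps sum.distrib sum_distrib_left)

lemma bounded_bilinear_vector_matrix_mult: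
  "bounded_bilinear ((v*) :: real ^ 'm \<Rightarrow> real ^ 'n ^ 'm \<Rightarrow> real ^ 'n)"
  unfolding bilinear_conv_bounded_bilinear[symmetric] bilinear_def
  by (auto intro!: linearI simp: vec_eq_iff vector_matrix_mult_def algebra_simps sum.distrib sum_distrib_left)

lemmas outer_product_simps =
  bounded_bilinear.add_left[OF bounded_bilinear_outer_product]
  bounded_bilinear.add_right[OF bounded_bilinear_outer_product]
  bounded_bilinear.diff_left[OF bounded_bilinear_outer_product]
  bounded_bilinear.diff_right[OF bounded_bilinear_outer_product]
  bounded_bilinear.scaleR_left[OF bounded_bilinear_outer_product]
  bounded_bilinear.scaleR_right[OF bounded_bilinear_outer_product]

lemmas outer_product_zero [simp] =
  bounded_bilinear.zero_left[OF bounded_bilinear_outer_product]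
  bounded_bilinear.zero_right[OF bounded_bilinear_outer_product]

lemma outer_product_mult_vec: "outer_product u v *v x = (v \<bullet> x) *\<^sub>R u"
  by (simp add: vec_eq_iff matrix_vector_mult_def inner_vec_def sum_distrib_left algebra_simps)

lemma vec_mult_outer_product: "x v* outer_product u v = (x \<bullet> u) *\<^sub>R v"
  by (simp add: vec_eq_iff vector_matrix_mult_def inner_vec_def sum_distrib_left sum_distrib_right algebra_simps)

lemma inner_outer_product: "W \<bullet> outer_product u v = u \<bullet> (W *v v)"
  by (simp add: inner_vec_def matrix_vector_mult_def sum_distrib_left algebra_simps)

lemma inner_outer_product': "W \<bullet> outer_product u v = v \<bullet> (u v* W)"
proof -
  have "W \<bullet> outer_product u v = (\<Sum>i\<in>UNIV. \<Sum>j\<in>UNIV. v $ j * (u $ i * W $ i $ j))"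
    by (simp add: inner_vec_def algebra_simps)
  also have "\<dots> = v \<bullet> (u v* W)"
    by (subst sum.swap) (simp add: inner_vec_def vector_matrix_mult_def sum_distrib_left algebra_simps)
  finally show ?thesis .
qed

lemma inner_outer_outer: "outer_product a b \<bullet> outer_product u v = (a \<bullet> u) * (b \<bullet> v)"
  by (simp add: inner_outer_product outer_product_mult_vec inner_commute)

lemma norm_outer_product: "norm (outer_product u v) = norm u * norm v"
  by (simp add: norm_eq_sqrt_inner inner_outer_outer real_sqrt_mult)

lemma outer_product_eq_0_iff [simp]: "outer_product u v = 0 \<longleftrightarrow> u = 0 \<or> v = 0"
  by (metis norm_outer_product norm_eq_zero mult_eq_0_iff)

text \<open>A column space of dimension one is a line; the coefficients of the columns with respect
  to a generator \<open>u\<close> form the second factor.\<close>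

lemma rank_one_iff_outer_product:
  fixes M :: "real ^ 'n ^ 'm"
  shows "rank M = 1 \<longleftrightarrow> (\<exists>u v. u \<noteq> 0 \<and> v \<noteq> 0 \<and> M = outer_product u v)"
proof
  assume r: "rank M = 1"
  then have "dim (columns M) = 1"
    by (simp add: column_rank_def)
  then obtain B where B: "independent B" "columns M \<subseteq> span B" "card B = 1"
    by (metis basis_exists)
  then obtain u where "B = {u}"
    by (auto simp: card_1_singleton_iff)
  then have "\<forall>j. \<exists>c. column j M = c *\<^sub>R u"
    using B(2) by (fastforce simp: columns_def span_singleton)
  then obtain c where c: "\<And>j. column j M = c j *\<^sub>R u"
    by metis
  have "M $ i $ j = outer_product u (\<chi> j. c j) $ i $ j" for i j
    using c[of j] by (simp add: column_def vec_eq_iff)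
  then have M: "M = outer_product u (\<chi> j. c j)"
    by (simp add: vec_eq_iff)
  moreover have "M \<noteq> 0"
    using r by auto
  ultimately show "\<exists>u v. u \<noteq> 0 \<and> v \<noteq> 0 \<and> M = outer_product u v"
    by (intro exI[of _ u] exI[of _ "\<chi> j. c j"]) auto
next
  assume "\<exists>u v. u \<noteq> 0 \<and> v \<noteq> 0 \<and> M = outer_product u v"
  then obtain u v where uv: "u \<noteq> 0" "v \<noteq> 0" and M: "M = outer_product u v"
    by blast
  have "range (\<lambda>x. M *v x) \<subseteq> span {u}"
    by (auto simp: M outer_product_mult_vec span_base span_scale)
  then have "rank M \<le> 1"
    unfolding rank_dim_range using dim_le_card[of _ "{u}"] by fastforce
  moreover have "rank M \<noteq> 0"
    using uv by (simp add: M rank_eq_0)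
  ultimately show "rank M = 1"
    by linarith
qed

section \<open>Continuous dependence of inverses and the implicit function theorem\<close>

lemma continuous_on_inv_blinfun:
  fixes F :: "'x::metric_space \<Rightarrow> 'a::euclidean_space \<Rightarrow>\<^sub>L 'a"
  assumes contF: "continuous_on S F" and bij: "\<And>x. x \<in> S \<Longrightarrow> bij (blinfun_apply (F x))"
  shows "continuous_on S (\<lambda>x. inv (blinfun_apply (F x)) w)"
  unfolding continuous_on_def
proof
  fix x0 assume x0: "x0 \<in> S"
  define a where "a = inv (blinfun_apply (F x0)) w"
  have Fa: "F x0 a = w"
    unfolding a_def by (rule surj_f_inv_f[OF bij_is_surj[OF bij[OF x0]]])
  obtain K where "K > 0" and K: "\<And>z. norm (F x0 z) \<ge> K * norm z"
    using linear_inj_bounded_below_pos[OF bounded_linear.linear[OF blinfun.bounded_linear_right] bij_is_inj[OF bij[OF x0]]]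
    by blast
  have lim: "(F \<longlongrightarrow> F x0) (at x0 within S)"
    using contF x0 by (simp add: continuous_on_def)
  have "\<forall>\<^sub>F x in at x0 within S. dist (F x) (F x0) < K / 2"
    using tendstoD[OF lim, of "K / 2"] \<open>K > 0\<close> by simp
  moreover have "\<forall>\<^sub>F x in at x0 within S. x \<in> S"
    by (simp add: eventually_at_filter)
  ultimately have "\<forall>\<^sub>F x in at x0 within S.
      norm (inv (blinfun_apply (F x)) w - a) \<le> norm (F x0 a - F x a) * (2 / K)"
  proof eventually_elim
    case (elim x)
    define z where "z = inv (blinfun_apply (F x)) w - a"
    \<comment> \<open>With \<open>a\<close> the solution for \<open>F x0\<close>, the error
      \<open>z\<close> solves an equation with operator \<open>F x\<close> whose right-hand side
      tends to 0. Since \<open>F x0\<close> is bounded below by \<open>K\<close>, operators within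
      \<open>K / 2\<close> of it are bounded below by \<open>K / 2\<close>, which bounds
      \<open>z\<close>.\<close>
    have Fz: "F x z = F x0 a - F x a"
      using surj_f_inv_f[OF bij_is_surj[OF bij[OF elim(2)]], of w] Fa
      by (simp add: z_def blinfun.diff_right)
    have "K * norm z \<le> norm (F x0 z)"
      by (rule K)
    also have "\<dots> \<le> norm (F x z) + norm ((F x0 - F x) z)"
      using norm_triangle_ineq[of "F x z" "(F x0 - F x) z"] by (simp add: blinfun.diff_left)
    also have "norm ((F x0 - F x) z) \<le> K / 2 * norm z"
      using elim(1) by (intro order_trans[OF norm_blinfun] mult_right_mono)
        (simp_all add: dist_norm norm_minus_commute)
    finally have "norm z \<le> norm (F x z) * (2 / K)"
      using \<open>K > 0\<close> by (simp add: field_simps)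
    then show ?case
      by (simp add: Fz flip: z_def)
  qed
  moreover have "((\<lambda>x. norm (F x0 a - F x a) * (2 / K)) \<longlongrightarrow> 0) (at x0 within S)"
    by (rule tendsto_eq_intros refl lim)+ simp
  ultimately have "((\<lambda>x. inv (blinfun_apply (F x)) w - a) \<longlongrightarrow> 0) (at x0 within S)"
    by (rule Lim_null_comparison)
  then show "((\<lambda>x. inv (blinfun_apply (F x)) w) \<longlongrightarrow> inv (blinfun_apply (F x0)) w) (at x0 within S)"
    by (simp add: a_def LIM_zero_iff)
qed

text \<open>In finite dimension, continuity of the derivative in operator norm follows from
  continuity in each fixed direction, so later proofs can work with plain functions as
  derivatives.\<close>

lemma C1_smooth_onI:
  fixes g :: "'a::euclidean_space \<Rightarrow> 'b::euclidean_space"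
  assumes der: "\<And>x. x \<in> U \<Longrightarrow> (g has_derivative g' x) (at x)"
    and cont: "\<And>d. continuous_on U (\<lambda>x. g' x d)"
  shows "C1_smooth_on U g"
  unfolding C1_smooth_on_def
proof (intro exI conjI ballI)
  have app: "blinfun_apply (Blinfun (g' x)) = g' x" if "x \<in> U" for x
    using der[OF that] by (simp add: has_derivative_def bounded_linear_Blinfun_apply)
  show "(g has_derivative blinfun_apply (Blinfun (g' x))) (at x)" if "x \<in> U" for x
    using der[OF that] app[OF that] by simp
  have "continuous_on U (\<lambda>x. blinfun_apply (Blinfun (g' x)) i)" for i
    using cont[of i] by (rule continuous_on_eq) (simp add: app)
  then show "continuous_on U (\<lambda>x. Blinfun (g' x))"
    by (intro continuous_on_blinfun_componentwise)
qed

text \<open>The inverse function theorem is applied to \<open>H (u, v) = (G (u, v), v)\<close>; the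
  implicit function is the first component of the inverse at \<open>(0, v)\<close>. Injectivity of
  \<open>H\<close> near the base point gives the uniqueness clause, which later identifies every
  nearby critical point with the one constructed.\<close>

lemma implicit_function_C1:
  fixes G :: "'a::euclidean_space \<times> 'b::euclidean_space \<Rightarrow> 'a"
  assumes der: "\<And>x. (G has_derivative G' x) (at x)"
    and cont: "\<And>d. continuous_on UNIV (\<lambda>x. G' x d)"
    and G0: "G (z0, v0) = 0"
    and inj: "\<And>h. G' (z0, v0) (h, 0) = 0 \<Longrightarrow> h = 0"
  obtains U W z where "open U" "v0 \<in> U" "open W" "(z0, v0) \<in> W" "z v0 = z0" "C1_smooth_on U z"
    "\<And>v. v \<in> U \<Longrightarrow> G (z v, v) = 0"
    "\<And>u v. (u, v) \<in> W \<Longrightarrow> v \<in> U \<Longrightarrow> G (u, v) = 0 \<Longrightarrow> u = z v"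
proof -
  define H where "H x = (G x, snd x)" for x
  define H' where "H' x = Blinfun (\<lambda>d. (G' x d, snd d))" for x
  have lin: "bounded_linear (G' x)" for x
    using der has_derivative_bounded_linear by blast
  have app: "blinfun_apply (H' x) = (\<lambda>d. (G' x d, snd d))" for x
    unfolding H'_def
    by (intro bounded_linear_Blinfun_apply bounded_linear_Pair lin bounded_linear_snd)
  have derH: "(H has_derivative blinfun_apply (H' x)) (at x)" for x
    unfolding H_def app by (intro has_derivative_Pair der has_derivative_snd has_derivative_ident)
  have contH: "continuous_on UNIV H'"
    by (intro continuous_on_blinfun_componentwise) (auto simp: app intro!: continuous_intros cont)
  have "inj (blinfun_apply (H' (z0, v0)))"
    unfolding linear_injective_0[OF bounded_linear.linear[OF blinfun.bounded_linear_right]]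
  proof safe
    fix h v assume "blinfun_apply (H' (z0, v0)) (h, v) = 0"
    then show "(h, v) = 0"
      using inj[of h] by (auto simp: app zero_prod_def)
  qed
  then obtain k where k: "linear k" "k \<circ> blinfun_apply (H' (z0, v0)) = id"
    using linear_injective_left_inverse[OF bounded_linear.linear[OF blinfun.bounded_linear_right]] by blast
  have "Blinfun k o\<^sub>L H' (z0, v0) = id_blinfun"
    using k by (intro blinfun_eqI; clarify)
      (simp add: linear_conv_bounded_linear bounded_linear_Blinfun_apply o_def fun_eq_iff split_paired_all)
  then obtain U' V g g' where "open U'" and U': "(z0, v0) \<in> U'" and "open V"
    and HV: "H (z0, v0) \<in> V" and hom: "homeomorphism U' V H g"
    and derg: "\<And>y. y \<in> V \<Longrightarrow> (g has_derivative g' y) (at y)"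
    and g': "\<And>y. y \<in> V \<Longrightarrow> g' y = inv (blinfun_apply (H' (g y)))"
    and bij: "\<And>y. y \<in> V \<Longrightarrow> bij (blinfun_apply (H' (g y)))"
    using inverse_function_theorem[OF open_UNIV derH contH UNIV_I] by metis
  have contg: "continuous_on V g"
    using hom by (simp add: homeomorphism_def)
  have contg': "continuous_on V (\<lambda>y. g' y d)" for d
  proof (rule continuous_on_eq)
    show "continuous_on V (\<lambda>y. inv (blinfun_apply (H' (g y))) d)"
      by (intro continuous_on_inv_blinfun bij continuous_on_compose2[OF contH contg]) auto
  qed (simp add: g')
  define U where "U = (\<lambda>v. (0, v)) -` V"
  have cont0: "continuous_on X (\<lambda>v. (0::'a, v::'b))" for X
    by (intro continuous_intros)
  have Hg: "H (g y) = y" if "y \<in> V" for y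
    using hom that by (simp add: homeomorphism_def)
  have gH: "g (H x) = x" if "x \<in> U'" for x
    using hom that by (simp add: homeomorphism_def)
  show thesis
  proof (rule that)
    show "open U"
      unfolding U_def by (rule open_vimage[OF \<open>open V\<close> cont0])
    show "v0 \<in> U"
      using HV by (simp add: U_def H_def G0)
    show "open U'" "(z0, v0) \<in> U'"
      by fact+
    show "fst (g (0, v0)) = z0"
      using gH[OF U'] by (simp add: H_def G0)
    show "C1_smooth_on U (\<lambda>v. fst (g (0, v)))"
    proof (rule C1_smooth_onI)
      fix v assume "v \<in> U"
      then have "(0, v) \<in> V" by (simp add: U_def)
      then have "(g has_derivative g' (0, v)) (at (0, v))"
        by (rule derg)
      then have "((\<lambda>v. g (0, v)) has_derivative (\<lambda>d. g' (0, v) (0, d))) (at v)"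
        by (rule has_derivative_compose[rotated])
          (auto intro!: derivative_eq_intros)
      then show "((\<lambda>v. fst (g (0, v))) has_derivative (\<lambda>d. fst (g' (0, v) (0, d)))) (at v)"
        by (rule has_derivative_fst)
    next
      fix d
      show "continuous_on U (\<lambda>v. fst (g' (0, v) (0, d)))"
        by (intro continuous_on_fst continuous_on_compose2[OF contg' cont0]) (auto simp: U_def)
    qed
    show "G (fst (g (0, v)), v) = 0" if "v \<in> U" for v
      using Hg[of "(0, v)"] that by (cases "g (0, v)") (auto simp: U_def H_def)
    show "u = fst (g (0, v))" if "(u, v) \<in> U'" "v \<in> U" "G (u, v) = 0" for u v
      using gH[OF that(1)] that(3) by (simp add: H_def)
  qed
qed

section \<open>Tilting a convex quadratic over the rank-one matrices\<close>

lemma rank_one_matrices_iff: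
  "M \<in> rank_one_matrices \<longleftrightarrow> (\<exists>u v. u \<noteq> 0 \<and> v \<noteq> 0 \<and> M = outer_product u v)"
  unfolding rank_one_matrices_def mem_Collect_eq rank_one_iff_outer_product ..

lemma tilt_argmin_iff:
  "\<theta> \<in> tilt_argmin S f \<theta>\<^sub>0 \<epsilon> V \<longleftrightarrow> \<theta> \<in> S \<and> dist \<theta>\<^sub>0 \<theta> \<le> \<epsilon> \<and>
     (\<forall>\<theta>'\<in>S. dist \<theta>\<^sub>0 \<theta>' \<le> \<epsilon> \<longrightarrow> f \<theta> - V \<bullet> \<theta> \<le> f \<theta>' - V \<bullet> \<theta>')"
  by (auto simp: tilt_argmin_def is_arg_min_linorder)

lemma eventually_add_scaleR_nonzero:
  fixes x y :: "'a::real_normed_vector"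
  assumes "x \<noteq> 0"
  shows "\<forall>\<^sub>F s in at 0. x + s *\<^sub>R y \<noteq> 0"
proof (rule tendsto_imp_eventually_ne)
  show "((\<lambda>s. x + s *\<^sub>R y) \<longlongrightarrow> x) (at 0)"
    by (rule tendsto_eq_intros refl | simp)+
qed fact

text \<open>The rank-one matrices are ruled: varying a single factor moves along a straight line.
  Criticality and degeneracy can thus be tested on lines instead of curves.\<close>

lemma eventually_rank_one_left:
  assumes "u \<noteq> 0" "v \<noteq> 0"
  shows "\<forall>\<^sub>F s in at 0. outer_product u v + s *\<^sub>R outer_product h v \<in> rank_one_matrices"
  using eventually_add_scaleR_nonzero[OF assms(1), of h]
proof eventually_elim
  case (elim s)
  moreover have "outer_product u v + s *\<^sub>R outer_product h v = outer_product (u + s *\<^sub>R h) v"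
    by (simp add: outer_product_simps)
  ultimately show ?case
    using assms rank_one_matrices_iff by blast
qed

lemma eventually_rank_one_right:
  assumes "u \<noteq> 0" "v \<noteq> 0"
  shows "\<forall>\<^sub>F s in at 0. outer_product u v + s *\<^sub>R outer_product u k \<in> rank_one_matrices"
  using eventually_add_scaleR_nonzero[OF assms(2), of k]
proof eventually_elim
  case (elim s)
  moreover have "outer_product u v + s *\<^sub>R outer_product u k = outer_product u (v + s *\<^sub>R k)"
    by (simp add: outer_product_simps)
  ultimately show ?case
    using assms rank_one_matrices_iff by blast
qed

text \<open>However small the radius, the ball contains a second point of the line that is no worse
  than the centre, whereas tilt stability demands that the untilted problem have the centre as its
  only solution.\<close>

lemma not_tilt_stable_minimizerI:
  assumes D: "D \<noteq> 0" and le: "\<And>s. f (\<theta>\<^sub>0 + s *\<^sub>R D) \<le> f \<theta>\<^sub>0"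
    and S: "\<forall>\<^sub>F s in at 0. \<theta>\<^sub>0 + s *\<^sub>R D \<in> S"
  shows "\<not> tilt_stable_minimizer S f \<theta>\<^sub>0"
proof
  assume "tilt_stable_minimizer S f \<theta>\<^sub>0"
  then obtain \<epsilon> where "\<epsilon> > 0" and min: "tilt_argmin S f \<theta>\<^sub>0 \<epsilon> 0 = {\<theta>\<^sub>0}"
    by (auto simp: tilt_stable_minimizer_def tilt_stable_radius_def)
  have "\<forall>\<^sub>F s in at 0. dist \<theta>\<^sub>0 (\<theta>\<^sub>0 + s *\<^sub>R D) < \<epsilon>"
  proof (rule order_tendstoD)
    show "((\<lambda>s. dist \<theta>\<^sub>0 (\<theta>\<^sub>0 + s *\<^sub>R D)) \<longlongrightarrow> 0) (at 0)"
      by (rule tendsto_eq_intros refl | simp)+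
  qed fact
  moreover have "\<forall>\<^sub>F s in at (0::real). s \<noteq> 0"
    by (simp add: eventually_at_filter)
  ultimately have "\<forall>\<^sub>F s in at 0. s \<noteq> 0 \<and> dist \<theta>\<^sub>0 (\<theta>\<^sub>0 + s *\<^sub>R D) < \<epsilon> \<and> \<theta>\<^sub>0 + s *\<^sub>R D \<in> S"
    using S by eventually_elim blast
  then obtain s where s: "s \<noteq> 0" "dist \<theta>\<^sub>0 (\<theta>\<^sub>0 + s *\<^sub>R D) < \<epsilon>" "\<theta>\<^sub>0 + s *\<^sub>R D \<in> S"
    using eventually_happens'[OF at_neq_bot] by blast
  have "\<theta>\<^sub>0 \<in> tilt_argmin S f \<theta>\<^sub>0 \<epsilon> 0"
    using min by simp
  then have "f \<theta>\<^sub>0 \<le> f \<theta>'" if "\<theta>' \<in> S" "dist \<theta>\<^sub>0 \<theta>' \<le> \<epsilon>" for \<theta>'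
    using that unfolding tilt_argmin_iff by simp
  then have "f (\<theta>\<^sub>0 + s *\<^sub>R D) \<le> f \<theta>'" if "\<theta>' \<in> S" "dist \<theta>\<^sub>0 \<theta>' \<le> \<epsilon>" for \<theta>'
    using that le[of s] order_trans by blast
  then have "\<theta>\<^sub>0 + s *\<^sub>R D \<in> tilt_argmin S f \<theta>\<^sub>0 \<epsilon> 0"
    using s unfolding tilt_argmin_iff by simp
  then show False
    using s D min by simp
qed

text \<open>Taking \<open>b1\<close> of unit length puts the whole scale of \<open>M0\<close> into
  \<open>b2\<close>, so \<open>M0\<close> has norm \<open>norm b2\<close>. Coercivity is demanded on
  all matrices, not only on tangent vectors, because minimizers are compared with \<open>M0\<close>
  along chords.\<close>

locale rank_one_quadratic =
  fixes A :: "real ^ 'n ^ 'm \<Rightarrow> real ^ 'n ^ 'm"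
    and b1 :: "real ^ 'm" and b2 :: "real ^ 'n"
    and f :: "real ^ 'n ^ 'm \<Rightarrow> real" and c0 c :: real and M0 :: "real ^ 'n ^ 'm"
  assumes lin: "linear A" and selfadj: "A x \<bullet> y = x \<bullet> A y"
    and c_pos: "c > 0" and coercive: "c * (norm x)\<^sup>2 \<le> A x \<bullet> x"
    and b1: "norm b1 = 1" and b2: "b2 \<noteq> 0"
    and f: "f M = c0 + A (M - M0) \<bullet> (M - M0) / 2"
    and M0: "M0 = outer_product b1 b2"
begin

abbreviation S :: "(real ^ 'n ^ 'm) set" where "S \<equiv> rank_one_matrices"

lemma b1_inner [simp]: "b1 \<bullet> b1 = 1"
  using b1 by (simp add: norm_eq_1)

lemma M0_in: "M0 \<in> S"
proof -
  have "b1 \<noteq> 0"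
    using b1 by auto
  with b2 show ?thesis
    unfolding rank_one_matrices_iff M0 by blast
qed

lemma coercive_nonneg: "0 \<le> A x \<bullet> x"
  using coercive[of x] mult_nonneg_nonneg[OF less_imp_le[OF c_pos] zero_le_power2[of "norm x"]]
  by linarith

lemma A_eq_0:
  assumes "A x \<bullet> x \<le> 0"
  shows "x = 0"
proof -
  have "c * (norm x)\<^sup>2 \<le> 0"
    using coercive[of x] assms by linarith
  then show ?thesis
    using c_pos by (simp add: mult_le_0_iff)
qed

lemma f_M0_le: "f M0 \<le> f M"
  using coercive_nonneg[of "M - M0"] linear_0[OF lin] by (simp add: f)

text \<open>Comparing with the competitor \<open>M0\<close> bounds half the energy of
  \<open>M - M0\<close> by a linear term in \<open>V\<close>, and coercivity turns this into a
  Lipschitz estimate. It is uniform in the radius, so for small tilts the minimizers avoid the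
  boundary of the ball.\<close>

lemma argmin_dist:
  assumes M: "M \<in> tilt_argmin S f M0 \<epsilon> V" and "\<epsilon> \<ge> 0"
  shows "norm (M - M0) \<le> 2 / c * norm V"
proof (cases "M = M0")
  case False
  have "f M - V \<bullet> M \<le> f M0 - V \<bullet> M0"
    using M M0_in \<open>\<epsilon> \<ge> 0\<close> by (auto simp: tilt_argmin_iff)
  then have "A (M - M0) \<bullet> (M - M0) / 2 \<le> V \<bullet> (M - M0)"
    using linear_0[OF lin] by (simp add: f inner_diff_right[of V])
  also have "\<dots> \<le> norm V * norm (M - M0)"
    by (rule norm_cauchy_schwarz)
  finally have "c * (norm (M - M0))\<^sup>2 \<le> 2 * norm V * norm (M - M0)"
    using coercive[of "M - M0"] by linarith
  then have "c * norm (M - M0) \<le> 2 * norm V"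
    using False by (simp add: power2_eq_square)
  then show ?thesis
    using c_pos by (simp add: field_simps)
qed (use c_pos in simp)

lemma first_order:
  assumes M: "M \<in> tilt_argmin S f M0 \<epsilon> V" and "dist M0 M < \<epsilon>"
    and D: "\<forall>\<^sub>F s in at 0. M + s *\<^sub>R D \<in> S"
  shows "(A (M - M0) - V) \<bullet> D = 0"
proof -
  define \<phi> where "\<phi> s = f (M + s *\<^sub>R D) - V \<bullet> (M + s *\<^sub>R D)" for s
  have A_line: "A (M + s *\<^sub>R D - M0) = A (M - M0) + s *\<^sub>R A D" for s
  proof -
    have "A (M + s *\<^sub>R D - M0) = A ((M - M0) + s *\<^sub>R D)"
      by (simp add: algebra_simps)
    then show ?thesis
      by (simp add: linear_add[OF lin] linear_scale[OF lin])
  qed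
  \<comment> \<open>Along a line the tilted objective is a quadratic polynomial in \<open>s\<close>,
    so the derivative at the local minimum 0 can be read off its linear coefficient.\<close>
  have "\<phi> s = c0 + (A (M - M0) \<bullet> (M - M0) + s * (2 * (A (M - M0) \<bullet> D)) + s\<^sup>2 * (A D \<bullet> D)) / 2
      - V \<bullet> M - s * (V \<bullet> D)" for s
    using selfadj[of D "M - M0"]
    by (simp add: \<phi>_def f A_line inner_simps inner_commute power2_eq_square algebra_simps)
  then have "\<phi> = (\<lambda>s. c0 + (A (M - M0) \<bullet> (M - M0) + s * (2 * (A (M - M0) \<bullet> D)) + s\<^sup>2 * (A D \<bullet> D)) / 2
      - V \<bullet> M - s * (V \<bullet> D))"
    by blast
  then have "(\<phi> has_real_derivative (A (M - M0) - V) \<bullet> D) (at 0)"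
    by (auto intro!: derivative_eq_intros simp: inner_diff_left)
  moreover have "\<forall>\<^sub>F s in at 0. dist M0 (M + s *\<^sub>R D) < \<epsilon>"
  proof (rule order_tendstoD)
    show "((\<lambda>s. dist M0 (M + s *\<^sub>R D)) \<longlongrightarrow> dist M0 M) (at 0)"
      by (rule tendsto_eq_intros refl | simp)+
  qed fact
  with D have "\<forall>\<^sub>F s in at 0. \<phi> 0 \<le> \<phi> s"
    by eventually_elim (use M in \<open>auto simp: tilt_argmin_iff \<phi>_def\<close>)
  then obtain d where "d > 0" "\<And>s. s \<noteq> 0 \<Longrightarrow> \<bar>s\<bar> < d \<Longrightarrow> \<phi> 0 \<le> \<phi> s"
    by (auto simp: eventually_at)
  then have "\<forall>s. \<bar>0 - s\<bar> < d \<longrightarrow> \<phi> 0 \<le> \<phi> s"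
    by (metis abs_minus diff_0 order_refl)
  ultimately show ?thesis
    using DERIV_local_min \<open>d > 0\<close> by blast
qed

lemma first_order_outer:
  assumes M: "outer_product u v \<in> tilt_argmin S f M0 \<epsilon> V" and "dist M0 (outer_product u v) < \<epsilon>"
  shows "(A (outer_product u v - M0) - V) *v v = 0" "u v* (A (outer_product u v - M0) - V) = 0"
proof -
  let ?W = "A (outer_product u v - M0) - V"
  have uv: "u \<noteq> 0" "v \<noteq> 0"
    using M by (auto simp: tilt_argmin_iff rank_one_matrices_def)
  have "?W \<bullet> outer_product h v = 0" for h
    by (rule first_order[OF assms eventually_rank_one_left[OF uv]])
  \<comment> \<open>Choosing the test vector equal to the expression itself makes its squared norm
    vanish.\<close>
  from this[of "?W *v v"] show "?W *v v = 0"
    by (simp add: inner_outer_product)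
  have "?W \<bullet> outer_product u k = 0" for k
    by (rule first_order[OF assms eventually_rank_one_right[OF uv]])
  from this[of "u v* ?W"] show "u v* ?W = 0"
    by (simp add: inner_outer_product')
qed

text \<open>A local inverse of multiplying out the factors, normalized by
  \<open>u \<bullet> b1 = 1\<close>: if \<open>M = outer_product u v\<close>, then
  \<open>M *v b2\<close> is \<open>(v \<bullet> b2) *\<^sub>R u\<close>, its product with
  \<open>b1\<close> is \<open>v \<bullet> b2\<close>, and \<open>b1 v* M\<close> is
  \<open>v\<close>.\<close>

definition chart :: "real ^ 'n ^ 'm \<Rightarrow> (real ^ 'm) \<times> (real ^ 'n)" where
  "chart M = ((1 / (b1 \<bullet> (M *v b2))) *\<^sub>R (M *v b2), b1 v* M)"

lemma inner_M0: "b1 \<bullet> (M0 *v b2) = (norm b2)\<^sup>2"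
  by (simp add: M0 outer_product_mult_vec power2_norm_eq_inner)

lemma chart_M0: "chart M0 = (b1, b2)"
  using b2 by (simp add: chart_def M0 outer_product_mult_vec vec_mult_outer_product)

text \<open>The denominator of \<open>chart\<close> is the inner product of \<open>M\<close> with
  \<open>M0\<close>; it equals the squared norm of \<open>b2\<close> at \<open>M0\<close> and
  changes by less than that within this distance.\<close>

lemma near_M0_pos:
  assumes "dist M0 M < norm b2"
  shows "b1 \<bullet> (M *v b2) > 0"
proof -
  have "b1 \<bullet> (M *v b2) = (norm b2)\<^sup>2 - (M0 - M) \<bullet> outer_product b1 b2"
    by (simp add: inner_outer_product matrix_vector_mult_diff_rdistrib inner_diff_right flip: inner_M0)
  moreover have "(M0 - M) \<bullet> outer_product b1 b2 \<le> dist M0 M * norm b2"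
    using norm_cauchy_schwarz[of "M0 - M" "outer_product b1 b2"]
    by (simp add: norm_outer_product b1 dist_norm)
  moreover have "dist M0 M * norm b2 < norm b2 * norm b2"
    using assms b2 by simp
  ultimately show ?thesis
    by (simp add: power2_eq_square)
qed

text \<open>Near \<open>M0\<close> having rank one is a polynomial equation, hence a closed
  condition. This makes the feasible set in a small closed ball compact and tilted minimizers
  exist.\<close>

lemma rank_one_near_M0:
  assumes "dist M0 M < norm b2"
  shows "M \<in> S \<longleftrightarrow> (b1 \<bullet> (M *v b2)) *\<^sub>R M = outer_product (M *v b2) (b1 v* M)"
proof
  assume "M \<in> S"
  then obtain u v where "M = outer_product u v"
    unfolding rank_one_matrices_iff by blast
  then show "(b1 \<bullet> (M *v b2)) *\<^sub>R M = outer_product (M *v b2) (b1 v* M)"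
    by (simp add: outer_product_mult_vec vec_mult_outer_product outer_product_simps mult.commute)
next
  let ?a = "b1 \<bullet> (M *v b2)"
  assume eq: "?a *\<^sub>R M = outer_product (M *v b2) (b1 v* M)"
  have a: "?a > 0"
    using assms by (rule near_M0_pos)
  have "M = (1 / ?a) *\<^sub>R (?a *\<^sub>R M)"
    using a by simp
  also have "\<dots> = outer_product ((1 / ?a) *\<^sub>R (M *v b2)) (b1 v* M)"
    by (simp only: eq outer_product_simps)
  finally have "M = outer_product ((1 / ?a) *\<^sub>R (M *v b2)) (b1 v* M)" .
  moreover have "M \<noteq> 0"
    using a by auto
  ultimately show "M \<in> S"
    unfolding rank_one_matrices_iff by (metis outer_product_eq_0_iff)
qed

lemma chart_inverse:
  assumes "dist M0 M < norm b2" "M \<in> S"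
  shows "outer_product (fst (chart M)) (snd (chart M)) = M" "fst (chart M) \<bullet> b1 = 1"
proof -
  have eq: "(b1 \<bullet> (M *v b2)) *\<^sub>R M = outer_product (M *v b2) (b1 v* M)"
    using rank_one_near_M0 assms by blast
  have "outer_product (fst (chart M)) (snd (chart M)) =
      (1 / (b1 \<bullet> (M *v b2))) *\<^sub>R ((b1 \<bullet> (M *v b2)) *\<^sub>R M)"
    unfolding eq by (simp add: chart_def outer_product_simps)
  then show "outer_product (fst (chart M)) (snd (chart M)) = M" "fst (chart M) \<bullet> b1 = 1"
    using near_M0_pos[OF assms(1)] by (simp_all add: chart_def inner_commute)
qed

lemmas bilinear_continuous_intros =
  bounded_bilinear.continuous_on[OF bounded_bilinear_outer_product]
  bounded_bilinear.continuous_on[OF bounded_bilinear_matrix_vector_mult]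
  bounded_bilinear.continuous_on[OF bounded_bilinear_vector_matrix_mult]

lemma A_continuous: "continuous_on X g \<Longrightarrow> continuous_on X (\<lambda>x. A (g x))"
  using lin by (rule bounded_linear.continuous_on[OF linear_conv_bounded_linear[THEN iffD1]])

lemma tilt_argmin_nonempty:
  assumes "0 \<le> \<epsilon>" "\<epsilon> < norm b2"
  shows "tilt_argmin S f M0 \<epsilon> V \<noteq> {}"
proof -
  let ?C = "{M. (b1 \<bullet> (M *v b2)) *\<^sub>R M = outer_product (M *v b2) (b1 v* M)}"
  have near: "dist M0 M < norm b2" if "M \<in> cball M0 \<epsilon>" for M
    using that assms by simp
  have "S \<inter> cball M0 \<epsilon> = cball M0 \<epsilon> \<inter> ?C"
    using rank_one_near_M0[OF near] by blast
  moreover have "closed ?C"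
    by (intro closed_Collect_eq continuous_on_scaleR continuous_on_inner continuous_on_const
      continuous_on_id bilinear_continuous_intros)
  ultimately have "compact (S \<inter> cball M0 \<epsilon>)"
    by (simp add: compact_Int_closed)
  moreover have "M0 \<in> S \<inter> cball M0 \<epsilon>"
    using M0_in assms by simp
  moreover have "continuous_on (S \<inter> cball M0 \<epsilon>) (\<lambda>M. f M - V \<bullet> M)"
    unfolding f by (intro continuous_on_diff continuous_on_add continuous_on_divide continuous_on_inner
      continuous_on_const continuous_on_id A_continuous) simp
  ultimately obtain M where "M \<in> S \<inter> cball M0 \<epsilon>" "\<forall>N\<in>S \<inter> cball M0 \<epsilon>. f M - V \<bullet> M \<le> f N - V \<bullet> N"
    using continuous_attains_inf by blast
  then have "M \<in> tilt_argmin S f M0 \<epsilon> V"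
    unfolding tilt_argmin_iff by simp
  then show ?thesis
    by blast
qed

text \<open>Critical points of the tilted problem in the coordinates \<open>M = outer_product u v\<close>; the term
  with \<open>b1\<close> fixes the scaling between \<open>u\<close> and \<open>v\<close>.\<close>

definition grad :: "((real ^ 'm) \<times> (real ^ 'n)) \<times> (real ^ 'n ^ 'm) \<Rightarrow> real ^ 'n ^ 'm" where
  "grad x = A (outer_product (fst (fst x)) (snd (fst x)) - M0) - snd x"

definition crit :: "((real ^ 'm) \<times> (real ^ 'n)) \<times> (real ^ 'n ^ 'm) \<Rightarrow> (real ^ 'm) \<times> (real ^ 'n)" where
  "crit x = (grad x *v snd (fst x) + (fst (fst x) \<bullet> b1 - 1) *\<^sub>R b1, fst (fst x) v* grad x)"

definition dgrad :: "((real ^ 'm) \<times> (real ^ 'n)) \<times> (real ^ 'n ^ 'm) \<Rightarrow>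
    ((real ^ 'm) \<times> (real ^ 'n)) \<times> (real ^ 'n ^ 'm) \<Rightarrow> real ^ 'n ^ 'm" where
  "dgrad x d = A (outer_product (fst (fst x)) (snd (fst d)) + outer_product (fst (fst d)) (snd (fst x))) - snd d"

definition dcrit :: "((real ^ 'm) \<times> (real ^ 'n)) \<times> (real ^ 'n ^ 'm) \<Rightarrow>
    ((real ^ 'm) \<times> (real ^ 'n)) \<times> (real ^ 'n ^ 'm) \<Rightarrow> (real ^ 'm) \<times> (real ^ 'n)" where
  "dcrit x d = (grad x *v snd (fst d) + dgrad x d *v snd (fst x) + (fst (fst d) \<bullet> b1) *\<^sub>R b1,
      fst (fst x) v* dgrad x d + fst (fst d) v* grad x)"

lemma has_derivative_grad: "(grad has_derivative dgrad x) (at x)"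
proof -
  have "((\<lambda>x. outer_product (fst (fst x)) (snd (fst x)) - M0) has_derivative
      (\<lambda>d. outer_product (fst (fst x)) (snd (fst d)) + outer_product (fst (fst d)) (snd (fst x)))) (at x)"
    by (auto intro!: derivative_eq_intros bounded_bilinear.FDERIV[OF bounded_bilinear_outer_product])
  then have "((\<lambda>x. A (outer_product (fst (fst x)) (snd (fst x)) - M0)) has_derivative
      (\<lambda>d. A (outer_product (fst (fst x)) (snd (fst d)) + outer_product (fst (fst d)) (snd (fst x))))) (at x)"
    by (rule bounded_linear.has_derivative[OF linear_conv_bounded_linear[THEN iffD1, OF lin]])
  then show ?thesis
    unfolding grad_def[abs_def] dgrad_def[abs_def]
    by (intro has_derivative_diff) (auto intro!: derivative_eq_intros)
qed

lemma has_derivative_crit: "(crit has_derivative dcrit x) (at x)"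
  unfolding crit_def[abs_def] dcrit_def[abs_def]
  by (rule has_derivative_eq_rhs)
    (auto intro!: derivative_eq_intros has_derivative_grad
      bounded_bilinear.FDERIV[OF bounded_bilinear_matrix_vector_mult]
      bounded_bilinear.FDERIV[OF bounded_bilinear_vector_matrix_mult])

lemma continuous_dcrit: "continuous_on UNIV (\<lambda>x. dcrit x d)"
  unfolding dcrit_def dgrad_def grad_def
  by (intro continuous_intros A_continuous bilinear_continuous_intros)

lemma grad_base: "grad ((b1, b2), 0) = 0"
  unfolding grad_def using linear_0[OF lin] by (simp add: M0)

text \<open>The normalization can share a component with the gradient equation without loss: pairing
  that component with \<open>b1\<close> leaves only \<open>h \<bullet> b1\<close>, because the
  second component already annihilates the gradient part. This keeps the numbers of equations and
  unknowns equal.\<close>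

lemma dcrit_base:
  assumes "dcrit ((b1, b2), 0) ((h, k), V) = 0"
  defines "\<Delta> \<equiv> outer_product h b2 + outer_product b1 k"
  shows "h \<bullet> b1 = 0" "(A \<Delta> - V) \<bullet> outer_product x b2 = 0" "(A \<Delta> - V) \<bullet> outer_product b1 y = 0"
proof -
  have dg: "dgrad ((b1, b2), 0) ((h, k), V) = A \<Delta> - V"
    by (simp add: dgrad_def \<Delta>_def add.commute)
  from assms(1) have 1: "(A \<Delta> - V) *v b2 + (h \<bullet> b1) *\<^sub>R b1 = 0" and 2: "b1 v* (A \<Delta> - V) = 0"
    by (simp_all add: dcrit_def grad_base dg zero_prod_def)
  from 2 show 3: "(A \<Delta> - V) \<bullet> outer_product b1 y = 0" for y
    by (simp add: inner_outer_product')
  have "b1 \<bullet> ((A \<Delta> - V) *v b2 + (h \<bullet> b1) *\<^sub>R b1) = 0"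
    using 1 by simp
  then show 4: "h \<bullet> b1 = 0"
    using 3[of b2] by (simp only: inner_outer_product inner_add_right) simp
  show "(A \<Delta> - V) \<bullet> outer_product x b2 = 0"
    using 1 4 by (simp add: inner_outer_product)
qed

text \<open>Testing the linearized equations with their own tangent vector gives zero energy, so the
  tangent vector vanishes. The condition \<open>h \<bullet> b1 = 0\<close> then excludes the one
  remaining ambiguity, a shift of \<open>h\<close> along \<open>b1\<close> compensated by
  \<open>k\<close> along \<open>b2\<close>.\<close>

lemma dcrit_base_inj:
  assumes "dcrit ((b1, b2), 0) (hk, 0) = 0"
  shows "hk = 0"
proof -
  obtain h k where hk: "hk = (h, k)" by fastforce
  let ?\<Delta> = "outer_product h b2 + outer_product b1 k"
  note * = dcrit_base[OF assms[unfolded hk]]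
  have "A ?\<Delta> \<bullet> ?\<Delta> = 0"
    using *(2)[of h] *(3)[of k] by (simp add: inner_add_right)
  then have \<Delta>: "?\<Delta> = 0"
    by (intro A_eq_0) simp
  then have "b1 v* ?\<Delta> = 0"
    by simp
  then have "k = 0"
    using *(1)
    by (simp add: bounded_bilinear.add_right[OF bounded_bilinear_vector_matrix_mult]
        vec_mult_outer_product inner_commute)
  moreover from this have "h = 0"
    using \<Delta> b2 by simp
  ultimately show ?thesis
    by (simp add: hk zero_prod_def)
qed

text \<open>Galerkin equations for the tangent space: the value lies in it, and the residual is
  orthogonal to both families that span it. Together with coercivity they determine
  \<open>L\<close>, with no reference to the chart or the radius.\<close>

definition is_tilt_derivative :: "(real ^ 'n ^ 'm \<Rightarrow> real ^ 'n ^ 'm) \<Rightarrow> bool" where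
  "is_tilt_derivative L \<longleftrightarrow> bounded_linear L \<and>
     (\<forall>V. \<exists>h k. L V = outer_product h b2 + outer_product b1 k) \<and>
     (\<forall>V x. (A (L V) - V) \<bullet> outer_product x b2 = 0) \<and>
     (\<forall>V y. (A (L V) - V) \<bullet> outer_product b1 y = 0)"

lemma tilt_stable_radius_small:
  assumes "0 < \<epsilon>" "\<epsilon> < norm b2"
  shows "tilt_stable_radius S f M0 \<epsilon>"
    and "\<exists>L. (tilt_map S f M0 \<epsilon> has_derivative L) (at 0) \<and> is_tilt_derivative L"
proof -
  have "crit ((b1, b2), 0) = 0"
    using linear_0[OF lin] by (simp add: crit_def grad_base zero_prod_def)
  then obtain U W z where U: "open U" "0 \<in> U" and W: "open W" "((b1, b2), 0) \<in> W"
    and z0: "z 0 = (b1, b2)" and z: "C1_smooth_on U z" "\<And>V. V \<in> U \<Longrightarrow> crit (z V, V) = 0"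
    and zW: "\<And>uv V. (uv, V) \<in> W \<Longrightarrow> V \<in> U \<Longrightarrow> crit (uv, V) = 0 \<Longrightarrow> uv = z V"
    by (rule implicit_function_C1[OF has_derivative_crit continuous_dcrit])
      (erule dcrit_base_inj, rule that)
  define \<sigma> where "\<sigma> V = outer_product (fst (z V)) (snd (z V))" for V
  obtain T1 T2 where T: "open T1" "(b1, b2) \<in> T1" "open T2" "0 \<in> T2" "T1 \<times> T2 \<subseteq> W"
    using open_prod_elim[OF W] by (metis mem_Sigma_iff)
  have "isCont (\<lambda>M. M *v b2) M0" "isCont (\<lambda>M. b1 v* M) M0"
    by (rule bounded_linear.continuous, rule bounded_bilinear.bounded_linear_left,
        rule bounded_bilinear_matrix_vector_mult, rule continuous_ident)
      (rule bounded_linear.continuous, rule bounded_bilinear.bounded_linear_right,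
        rule bounded_bilinear_vector_matrix_mult, rule continuous_ident)
  then have "isCont chart M0"
    unfolding chart_def using inner_M0 b2
    by (intro continuous_Pair continuous_scaleR continuous_at_within_divide continuous_inner
      continuous_const) simp_all
  then have "\<forall>\<^sub>F M in at M0. chart M \<in> T1"
    unfolding isCont_def by (rule topological_tendstoD) (use T chart_M0 in auto)
  then obtain r where "r > 0" and r0: "\<And>M. M \<noteq> M0 \<Longrightarrow> dist M M0 < r \<Longrightarrow> chart M \<in> T1"
    unfolding eventually_at by blast
  have r: "chart M \<in> T1" if "dist M M0 < r" for M
    using r0[OF _ that] T(2) chart_M0 by (cases "M = M0") auto
  \<comment> \<open>By \<open>argmin_dist\<close>, tilts shorter than this have their minimizers
    within \<open>min r \<epsilon>\<close> of \<open>M0\<close>: \<open>r\<close> brings the chart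
    into the uniqueness neighbourhood, and \<open>\<epsilon>\<close> makes them interior.\<close>
  define \<delta> where "\<delta> = min r \<epsilon> * c / 2"
  have \<delta>: "\<delta> > 0"
    using \<open>r > 0\<close> assms c_pos by (simp add: \<delta>_def)
  define U' where "U' = U \<inter> T2 \<inter> ball 0 \<delta>"
  have U': "open U'" "0 \<in> U'"
    using U T \<delta> by (auto simp: U'_def)
  have argmin: "tilt_argmin S f M0 \<epsilon> V = {\<sigma> V}" if V: "V \<in> U'" for V
  proof -
    have "M = \<sigma> V" if M: "M \<in> tilt_argmin S f M0 \<epsilon> V" for M
    proof -
      have "norm (M - M0) \<le> 2 / c * norm V"
        using argmin_dist M assms by simp
      also have "\<dots> < 2 / c * \<delta>"
        using V c_pos by (intro mult_strict_left_mono) (simp_all add: U'_def)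
      also have "\<dots> = min r \<epsilon>"
        using c_pos by (simp add: \<delta>_def)
      finally have near: "dist M0 M < r" "dist M0 M < \<epsilon>"
        by (simp_all add: dist_norm norm_minus_commute)
      have "M \<in> S" "dist M0 M < norm b2"
        using M near assms by (auto simp: tilt_argmin_iff)
      note ch = chart_inverse[OF this(2,1)]
      \<comment> \<open>The gradient parts vanish by the first-order conditions at an interior
        minimizer, and the normalization term vanishes because the chart satisfies it
        exactly.\<close>
      have "crit (chart M, V) = 0"
        using first_order_outer[of "fst (chart M)" "snd (chart M)" \<epsilon> V] M near
        unfolding ch by (simp add: crit_def grad_def ch zero_prod_def)
      moreover have "(chart M, V) \<in> W"
        using r[of M] near V T(5) by (auto simp: dist_commute U'_def)
      ultimately have "chart M = z V"
        using zW V by (auto simp: U'_def)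
      then show ?thesis
        using ch by (simp add: \<sigma>_def)
    qed
    then show ?thesis
      using tilt_argmin_nonempty[of \<epsilon> V] assms by fastforce
  qed
  then have map: "tilt_map S f M0 \<epsilon> V = \<sigma> V" if "V \<in> U'" for V
    using that by (simp add: tilt_map_def)
  obtain z' where z': "\<And>V. V \<in> U \<Longrightarrow> (z has_derivative blinfun_apply (z' V)) (at V)" "continuous_on U z'"
    using z(1) by (auto simp: C1_smooth_on_def)
  define \<sigma>' where "\<sigma>' V d = outer_product (fst (z V)) (snd (z' V d)) + outer_product (fst (z' V d)) (snd (z V))"
    for V d
  have der: "(tilt_map S f M0 \<epsilon> has_derivative \<sigma>' V) (at V)" if "V \<in> U'" for V
  proof (rule has_derivative_transform_within_open[OF _ U'(1) that])
    show "(\<sigma> has_derivative \<sigma>' V) (at V)"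
      unfolding \<sigma>_def[abs_def] \<sigma>'_def[abs_def] using that
      by (intro bounded_bilinear.FDERIV[OF bounded_bilinear_outer_product]
        has_derivative_fst has_derivative_snd z') (auto simp: U'_def)
  qed (simp add: map)
  have "continuous_on U z"
    using z'(1) by (meson continuous_at_imp_continuous_on has_derivative_continuous)
  then have "continuous_on U' z" "continuous_on U' z'"
    using z'(2) by (auto intro: continuous_on_subset simp: U'_def)
  then have cont: "continuous_on U' (\<lambda>V. \<sigma>' V d)" for d
    unfolding \<sigma>'_def by (intro continuous_intros bilinear_continuous_intros)
  show "tilt_stable_radius S f M0 \<epsilon>"
    unfolding tilt_stable_radius_def
  proof (intro conjI exI[of _ U'] ballI)
    show "tilt_argmin S f M0 \<epsilon> 0 = {M0}"
      using argmin[OF U'(2)] by (simp add: \<sigma>_def z0 M0)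
    show "C1_smooth_on U' (tilt_map S f M0 \<epsilon>)"
      using der cont by (rule C1_smooth_onI)
    show "\<And>V. V \<in> U' \<Longrightarrow> is_singleton (tilt_argmin S f M0 \<epsilon> V)"
      by (simp add: argmin)
  qed fact+
  show "\<exists>L. (tilt_map S f M0 \<epsilon> has_derivative L) (at 0) \<and> is_tilt_derivative L"
  proof (intro exI conjI)
    show der0: "(tilt_map S f M0 \<epsilon> has_derivative \<sigma>' 0) (at 0)"
      by (rule der) fact
    \<comment> \<open>Differentiating the identity \<open>crit (z V, V) = 0\<close> at the origin
      gives the linear equations analysed in \<open>dcrit_base\<close>.\<close>
    have "((\<lambda>V. crit (z V, V)) has_derivative (\<lambda>d. dcrit (z 0, 0) (z' 0 d, d))) (at 0)"
      by (rule has_derivative_compose[where f = "\<lambda>V. (z V, V)", OF _ has_derivative_crit])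
        (intro has_derivative_Pair z' U has_derivative_ident)
    moreover have "((\<lambda>V. crit (z V, V)) has_derivative (\<lambda>d. 0)) (at 0)"
      by (rule has_derivative_transform_within_open[OF has_derivative_const U]) (simp add: z)
    ultimately have "(\<lambda>d. dcrit (z 0, 0) (z' 0 d, d)) = (\<lambda>d. 0)"
      by (rule has_derivative_unique)
    then have *: "dcrit ((b1, b2), 0) ((fst (z' 0 d), snd (z' 0 d)), d) = 0" for d
      by (simp add: z0 fun_eq_iff)
    have L: "\<sigma>' 0 d = outer_product (fst (z' 0 d)) b2 + outer_product b1 (snd (z' 0 d))" for d
      by (simp add: \<sigma>'_def z0)
    show "is_tilt_derivative (\<sigma>' 0)"
      unfolding is_tilt_derivative_def
    proof (intro conjI allI)
      show "bounded_linear (\<sigma>' 0)"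
        using der0 by (rule has_derivative_bounded_linear)
      show "\<exists>h k. \<sigma>' 0 V = outer_product h b2 + outer_product b1 k" for V
        using L by blast
      show "(A (\<sigma>' 0 V) - V) \<bullet> outer_product x b2 = 0" for V x
        using dcrit_base(2)[OF *[of V]] by (simp add: L)
      show "(A (\<sigma>' 0 V) - V) \<bullet> outer_product b1 y = 0" for V y
        using dcrit_base(3)[OF *[of V]] by (simp add: L)
    qed
  qed
qed

lemma tilt_stable: "tilt_stable_minimizer S f M0"
  unfolding tilt_stable_minimizer_def is_arg_min_linorder
  using M0_in f_M0_le tilt_stable_radius_small(1)[of "norm b2 / 2"] b2 by auto

text \<open>\<open>REG\<close> takes an arbitrary qualifying radius, possibly beyond the range
  handled above. For small tilts the minimizer in the larger ball already lies in the smaller one by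
  \<open>argmin_dist\<close>, so it solves both problems.\<close>

lemma tilt_map_radius_cong:
  assumes "tilt_stable_radius S f M0 \<epsilon>" "tilt_stable_radius S f M0 \<epsilon>'"
  shows "\<exists>U. open U \<and> 0 \<in> U \<and> (\<forall>V\<in>U. tilt_map S f M0 \<epsilon> V = tilt_map S f M0 \<epsilon>' V)"
  using assms
proof (induction \<epsilon> \<epsilon>' rule: linorder_wlog)
  case (le \<epsilon> \<epsilon>')
  obtain U U' where U: "open U" "0 \<in> U" "\<forall>V\<in>U. is_singleton (tilt_argmin S f M0 \<epsilon> V)"
    and U': "open U'" "0 \<in> U'" "\<forall>V\<in>U'. is_singleton (tilt_argmin S f M0 \<epsilon>' V)"
    and pos: "\<epsilon> > 0" "\<epsilon>' > 0"
    using le.prems by (auto simp: tilt_stable_radius_def)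
  have "tilt_map S f M0 \<epsilon> V = tilt_map S f M0 \<epsilon>' V" if V: "V \<in> U \<inter> U' \<inter> ball 0 (\<epsilon> * c / 2)" for V
  proof -
    obtain M N where M: "tilt_argmin S f M0 \<epsilon> V = {M}" and N: "tilt_argmin S f M0 \<epsilon>' V = {N}"
      using U(3) U'(3) V unfolding is_singleton_def by blast
    have "norm (N - M0) \<le> 2 / c * norm V"
      using argmin_dist[of N \<epsilon>' V] N pos by simp
    also have "\<dots> \<le> 2 / c * (\<epsilon> * c / 2)"
      using V c_pos by (intro mult_left_mono) auto
    finally have "dist M0 N \<le> \<epsilon>"
      using c_pos by (simp add: dist_norm norm_minus_commute)
    then have "N \<in> tilt_argmin S f M0 \<epsilon> V"
      using N \<open>\<epsilon> \<le> \<epsilon>'\<close> by (fastforce simp: tilt_argmin_iff set_eq_iff)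
    then show ?thesis
      using M N by (simp add: tilt_map_def)
  qed
  then show ?case
    using U U' pos c_pos by (intro exI[of _ "U \<inter> U' \<inter> ball 0 (\<epsilon> * c / 2)"]) auto
next
  case (sym \<epsilon> \<epsilon>')
  then show ?case
    by (metis (no_types, lifting))
qed

theorem REG_eq: "\<exists>L. is_tilt_derivative L \<and> REG S f M0 = ennreal (onorm L)"
proof -
  define \<epsilon> where "\<epsilon> = norm b2 / 2"
  define \<epsilon>' where "\<epsilon>' = (SOME \<epsilon>. tilt_stable_radius S f M0 \<epsilon>)"
  have \<epsilon>: "0 < \<epsilon>" "\<epsilon> < norm b2"
    using b2 by (simp_all add: \<epsilon>_def)
  note r = tilt_stable_radius_small[OF \<epsilon>]
  have "tilt_stable_radius S f M0 \<epsilon>'"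
    unfolding \<epsilon>'_def using r(1) by (rule someI)
  from tilt_map_radius_cong[OF r(1) this]
  obtain U where U: "open U" "0 \<in> U" "\<And>V. V \<in> U \<Longrightarrow> tilt_map S f M0 \<epsilon> V = tilt_map S f M0 \<epsilon>' V"
    by blast
  obtain L where L: "(tilt_map S f M0 \<epsilon> has_derivative L) (at 0)" "is_tilt_derivative L"
    using r(2) by blast
  have "(tilt_map S f M0 \<epsilon>' has_derivative L) (at 0)"
    by (rule has_derivative_transform_within_open[OF L(1) U])
  then have "frechet_derivative (tilt_map S f M0 \<epsilon>') (at 0) = L"
    using frechet_derivative_at by metis
  then have "REG S f M0 = ennreal (onorm L)"
    using tilt_stable by (simp add: REG_def \<epsilon>'_def)
  then show ?thesis
    using L by blast
qed

end

section \<open>Norm bounds and extreme eigenvalues\<close>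

context rank_one_quadratic
begin

lemma tilt_derivative_bounded_linear: "is_tilt_derivative L \<Longrightarrow> bounded_linear L"
  by (simp add: is_tilt_derivative_def)

text \<open>\<open>L V\<close> is itself an admissible test vector in the Galerkin
  equations.\<close>

lemma tilt_derivative_energy:
  assumes "is_tilt_derivative L"
  shows "A (L V) \<bullet> L V = V \<bullet> L V"
proof -
  obtain h k where L: "L V = outer_product h b2 + outer_product b1 k"
    using assms unfolding is_tilt_derivative_def by blast
  have "(A (L V) - V) \<bullet> outer_product h b2 = 0" "(A (L V) - V) \<bullet> outer_product b1 k = 0"
    using assms unfolding is_tilt_derivative_def by blast+
  then have "(A (L V) - V) \<bullet> (outer_product h b2 + outer_product b1 k) = 0"
    by (simp only: inner_add_right)
  then have "(A (L V) - V) \<bullet> L V = 0"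
    by (simp only: L)
  then show ?thesis
    by (simp add: inner_diff_left)
qed

text \<open>For tangent \<open>z\<close>, nonnegativity of the energy of \<open>z - L t\<close>
  gives the variational bound t . L t \<ge> 2 t . z - A z . z. The choice
  \<open>z = (1 / q) *\<^sub>R t\<close> makes the right-hand side at least |t|^2 / q.\<close>

lemma onorm_tilt_derivative_ge:
  assumes L: "is_tilt_derivative L"
    and t: "t = outer_product x b2 \<or> t = outer_product b1 y" "t \<noteq> 0"
    and q: "q > 0" "A t \<bullet> t \<le> q * (norm t)\<^sup>2"
  shows "1 / q \<le> onorm L"
proof -
  have "(A (L t) - t) \<bullet> t = 0"
    using L t(1) unfolding is_tilt_derivative_def by blast
  then have 1: "A (L t) \<bullet> t = (norm t)\<^sup>2"
    by (simp add: inner_diff_left power2_norm_eq_inner)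
  let ?z = "L t - (1 / q) *\<^sub>R t"
  have "A ?z = A (L t) - (1 / q) *\<^sub>R A t"
    by (simp only: linear_diff[OF lin] linear_scale[OF lin])
  then have "A ?z \<bullet> ?z = (A (L t) - (1 / q) *\<^sub>R A t) \<bullet> ?z"
    by (rule arg_cong)
  also have "\<dots> = A (L t) \<bullet> L t - 2 / q * (A (L t) \<bullet> t) + (1 / q)\<^sup>2 * (A t \<bullet> t)"
    using selfadj[of t "L t"]
    by (simp add: inner_diff_left inner_diff_right inner_commute power2_eq_square algebra_simps)
  finally have "0 \<le> t \<bullet> L t - 2 / q * (norm t)\<^sup>2 + (1 / q)\<^sup>2 * (A t \<bullet> t)"
    using coercive_nonneg[of ?z] by (simp add: tilt_derivative_energy[OF L] 1)
  also have "\<dots> \<le> t \<bullet> L t - 2 / q * (norm t)\<^sup>2 + (1 / q)\<^sup>2 * (q * (norm t)\<^sup>2)"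
    using q by (intro add_left_mono mult_left_mono) auto
  also have "\<dots> = t \<bullet> L t - (norm t)\<^sup>2 / q"
    using q by (simp add: power2_eq_square field_simps)
  finally have "(norm t)\<^sup>2 / q \<le> t \<bullet> L t"
    by simp
  also have "\<dots> \<le> norm t * norm (L t)"
    by (rule norm_cauchy_schwarz)
  also have "\<dots> \<le> norm t * (onorm L * norm t)"
    by (intro mult_left_mono onorm tilt_derivative_bounded_linear L) simp
  finally have "(norm t)\<^sup>2 * (1 / q) \<le> (norm t)\<^sup>2 * onorm L"
    by (simp add: power2_eq_square mult_ac)
  then show ?thesis
    using t(2) by (subst (asm) mult_le_cancel_left_pos) simp_all
qed

text \<open>Wielandt's inequality in disguise: for orthogonal \<open>x\<close> and \<open>y\<close>, the vectors \<open>x + y\<close> and \<open>x - y\<close>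
  have equal norms, so their energies differ at most by the condition number.\<close>

lemma orthogonal_energy:
  assumes upper: "\<And>z. A z \<bullet> z \<le> m * (norm z)\<^sup>2" and "x \<bullet> y = 0"
  shows "A x \<bullet> x + A y \<bullet> y \<le> (m / c + 1) / 2 * (A (x + y) \<bullet> (x + y))"
proof -
  have par: "A (x + y) \<bullet> (x + y) + A (x - y) \<bullet> (x - y) = 2 * (A x \<bullet> x + A y \<bullet> y)"
    by (simp add: linear_add[OF lin] linear_diff[OF lin] inner_add_left inner_add_right
        inner_diff_left inner_diff_right)
  \<comment> \<open>The nonzero matrix \<open>M0\<close> serves as a test vector for the sign of
    \<open>m\<close>.\<close>
  have "0 \<le> m * (norm b1)\<^sup>2 * (norm b2)\<^sup>2"
    using order_trans[OF coercive_nonneg upper, of M0] by (simp add: M0 norm_outer_product power_mult_distrib mult.assoc)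
  then have "0 \<le> m"
    using b1 b2 by (simp add: zero_le_mult_iff)
  have nn: "(norm (x - y))\<^sup>2 = (norm (x + y))\<^sup>2"
    using assms(2) by (simp add: power2_norm_eq_inner inner_add_left inner_add_right
        inner_diff_left inner_diff_right inner_commute)
  have "A (x - y) \<bullet> (x - y) \<le> m * (norm (x + y))\<^sup>2"
    using upper[of "x - y"] nn by simp
  also have "\<dots> = m / c * (c * (norm (x + y))\<^sup>2)"
    using c_pos by simp
  also have "\<dots> \<le> m / c * (A (x + y) \<bullet> (x + y))"
    using c_pos \<open>0 \<le> m\<close> by (intro mult_left_mono coercive) simp
  finally have "2 * (A x \<bullet> x + A y \<bullet> y) \<le> A (x + y) \<bullet> (x + y) + m / c * (A (x + y) \<bullet> (x + y))"
    using par by linarith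
  moreover have "(m / c + 1) / 2 * e = (e + m / c * e) / 2" for e
    by (simp add: algebra_simps)
  ultimately show ?thesis
    by simp
qed

text \<open>The lower bound \<open>p\<close> holds only on the two families, not on their sums. For
  an orthogonal splitting the squared norms add up exactly, so the only loss is in recombining the
  two energies by \<open>orthogonal_energy\<close>.\<close>

lemma onorm_tilt_derivative_le:
  assumes L: "is_tilt_derivative L" and upper: "\<And>z. A z \<bullet> z \<le> m * (norm z)\<^sup>2"
    and p: "p > 0" "\<And>x. p * (norm (outer_product x b2))\<^sup>2 \<le> A (outer_product x b2) \<bullet> outer_product x b2"
      "\<And>y. p * (norm (outer_product b1 y))\<^sup>2 \<le> A (outer_product b1 y) \<bullet> outer_product b1 y"
  shows "onorm L \<le> (m / c + 1) / 2 / p"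
proof (rule onorm_le)
  fix V
  let ?C = "(m / c + 1) / 2"
  obtain h k where hk: "L V = outer_product h b2 + outer_product b1 k"
    using L unfolding is_tilt_derivative_def by blast
  \<comment> \<open>The splitting of a tangent vector is unique only up to multiples of
    \<open>outer_product b1 b2\<close>. This multiple removes the component of \<open>k\<close>
    along \<open>b2\<close>, which makes the two pieces orthogonal.\<close>
  define a where "a = (k \<bullet> b2) / (b2 \<bullet> b2)"
  define x where "x = outer_product (h + a *\<^sub>R b1) b2"
  define y where "y = outer_product b1 (k - a *\<^sub>R b2)"
  have LV: "L V = x + y"
    by (simp add: hk x_def y_def outer_product_simps)
  have "x \<bullet> y = 0"
    using b2 by (simp add: x_def y_def inner_outer_outer a_def inner_diff_right inner_commute)
  note energy = orthogonal_energy[OF upper this]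
  have "p * (norm (L V))\<^sup>2 = p * (norm x)\<^sup>2 + p * (norm y)\<^sup>2"
    using \<open>x \<bullet> y = 0\<close>
    by (simp add: LV power2_norm_eq_inner inner_add_left inner_add_right inner_commute algebra_simps)
  also have "\<dots> \<le> A x \<bullet> x + A y \<bullet> y"
    unfolding x_def y_def by (intro add_mono p)
  also have "\<dots> \<le> ?C * (V \<bullet> L V)"
    using energy unfolding LV[symmetric] tilt_derivative_energy[OF L] .
  finally have *: "p * (norm (L V))\<^sup>2 \<le> ?C * (V \<bullet> L V)" .
  have "0 \<le> V \<bullet> L V"
    using coercive_nonneg[of "L V"] tilt_derivative_energy[OF L] by simp
  show "norm (L V) \<le> ?C / p * norm V"
  proof (cases "L V = 0")
    case True
    \<comment> \<open>When \<open>L V\<close> vanishes, all that remains is nonnegativity of the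
      constant; \<open>M0\<close> belongs to both families and yields \<open>m > 0\<close>.\<close>
    have "0 < p * (norm M0)\<^sup>2"
      using p(1) b1 b2 by (auto simp: M0 norm_outer_product)
    also have "\<dots> \<le> m * (norm M0)\<^sup>2"
      using p(2)[of b1] upper[of M0] by (simp add: M0)
    finally have "m > 0"
      using b1 b2 by (auto simp: M0 zero_less_mult_iff)
    then show ?thesis
      using True p(1) c_pos by simp
  next
    case False
    have "V \<bullet> L V \<noteq> 0"
      using * False p(1) by (auto simp: mult_le_0_iff)
    then have "0 < V \<bullet> L V"
      using \<open>0 \<le> V \<bullet> L V\<close> by simp
    moreover have "0 < ?C * (V \<bullet> L V)"
      using * False p(1) by (intro less_le_trans[OF _ *] mult_pos_pos) auto
    ultimately have "?C > 0"
      by (simp add: zero_less_mult_iff)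
    have "p * (norm (L V))\<^sup>2 \<le> ?C * (norm V * norm (L V))"
      using * norm_cauchy_schwarz[of V "L V"] \<open>?C > 0\<close>
      by (meson less_imp_le mult_left_mono order_trans)
    then have "(p * norm (L V)) * norm (L V) \<le> (?C * norm V) * norm (L V)"
      by (simp only: power2_eq_square mult_ac)
    then have "p * norm (L V) \<le> ?C * norm V"
      using False by (subst (asm) mult_le_cancel_right) auto
    then show ?thesis
      using p(1) by (simp add: field_simps)
  qed
qed

end

section \<open>Extreme eigenvalues of symmetric matrices through Rayleigh quotients\<close>

lemma linear_part_zero:
  fixes a b :: real
  assumes "\<And>s. 0 \<le> 2 * s * a + s\<^sup>2 * b"
  shows "a = 0"
proof (rule ccontr)
  assume "a \<noteq> 0"
  define B where "B = \<bar>b\<bar> + 1"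
  have B: "B > 0" "b \<le> B"
    by (auto simp: B_def)
  \<comment> \<open>This \<open>s\<close> minimizes the quadratic with \<open>b\<close> replaced by
    its positive upper bound \<open>B\<close>.\<close>
  have "0 \<le> 2 * (- a / B) * a + (- a / B)\<^sup>2 * b"
    by (rule assms)
  also have "\<dots> \<le> 2 * (- a / B) * a + (- a / B)\<^sup>2 * B"
    using B by (intro add_left_mono mult_left_mono) auto
  also have "\<dots> = - (a\<^sup>2 / B)"
    using B by (simp add: power2_eq_square field_simps)
  finally show False
    using B \<open>a \<noteq> 0\<close> by (simp add: field_simps)
qed

lemma symmetric_inner:
  fixes S :: "real ^ 'n ^ 'n"
  assumes "transpose S = S"
  shows "(S *v x) \<bullet> y = x \<bullet> (S *v y)"
  using dot_lmul_matrix[of y S x] assms by (metis inner_commute transpose_matrix_vector)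

lemma ex_min_eigenvector:
  fixes S :: "real ^ 'n ^ 'n"
  assumes "transpose S = S"
  shows "\<exists>u l. norm u = 1 \<and> S *v u = l *\<^sub>R u \<and> (\<forall>x. l * (norm x)\<^sup>2 \<le> (S *v x) \<bullet> x)"
proof -
  have "continuous_on (sphere 0 1) (\<lambda>x. (S *v x) \<bullet> x)"
    by (intro continuous_on_inner bounded_bilinear.continuous_on[OF bounded_bilinear_matrix_vector_mult]
        continuous_on_const continuous_on_id)
  then obtain u where u: "u \<in> sphere 0 1" and
      min: "\<And>x. x \<in> sphere 0 1 \<Longrightarrow> (S *v u) \<bullet> u \<le> (S *v x) \<bullet> x"
    using continuous_attains_inf[OF compact_sphere[of "0 :: real ^ 'n" 1]] by fastforce
  define l where "l = (S *v u) \<bullet> u"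
  have ray: "l * (norm x)\<^sup>2 \<le> (S *v x) \<bullet> x" for x
  proof (cases "x = 0")
    case False
    have "l \<le> (S *v (x /\<^sub>R norm x)) \<bullet> (x /\<^sub>R norm x)"
      unfolding l_def using False by (intro min) simp
    also have "\<dots> = ((S *v x) \<bullet> x) / (norm x)\<^sup>2"
      by (simp add: matrix_vector_mult_scaleR power2_eq_square divide_inverse)
    finally show ?thesis
      using False by (simp add: field_simps)
  qed simp
  have u1: "norm u = 1"
    using u by simp
  then have uu: "u \<bullet> u = 1"
    by (simp add: norm_eq_1)
  \<comment> \<open>The residual is used as the direction of variation: the first-order coefficient
    of the Rayleigh inequality along it is its own squared norm, which forces it to vanish.\<close>
  let ?y = "S *v u - l *\<^sub>R u"
  have "0 \<le> 2 * s * (?y \<bullet> ?y) + s\<^sup>2 * ((S *v ?y) \<bullet> ?y - l * (?y \<bullet> ?y))" for s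
  proof -
    define y where "y = ?y"
    have e1: "l * (norm (u + s *\<^sub>R y))\<^sup>2 \<le> (S *v (u + s *\<^sub>R y)) \<bullet> (u + s *\<^sub>R y)"
      by (rule ray)
    have e2: "(S *v (u + s *\<^sub>R y)) \<bullet> (u + s *\<^sub>R y) = l + 2 * s * ((S *v u) \<bullet> y) + s\<^sup>2 * ((S *v y) \<bullet> y)"
      using symmetric_inner[OF assms, of y u]
      by (simp add: matrix_vector_mult_scaleR matrix_vector_right_distrib inner_add_left inner_add_right
          l_def power2_eq_square inner_commute algebra_simps)
    have e3: "(norm (u + s *\<^sub>R y))\<^sup>2 = 1 + 2 * s * (u \<bullet> y) + s\<^sup>2 * (y \<bullet> y)"
      unfolding power2_norm_eq_inner
      by (simp add: inner_add_left inner_add_right uu power2_eq_square inner_commute algebra_simps)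
    have e4: "(S *v u) \<bullet> y = y \<bullet> y + l * (u \<bullet> y)"
      by (simp add: y_def inner_diff_left)
    have "0 \<le> 2 * s * (y \<bullet> y) + s\<^sup>2 * ((S *v y) \<bullet> y - l * (y \<bullet> y))"
      using e1 unfolding e2 e3 e4 by (simp add: algebra_simps)
    then show ?thesis
      by (simp only: y_def)
  qed
  then have "?y \<bullet> ?y = 0"
    by (rule linear_part_zero)
  then have "S *v u = l *\<^sub>R u"
    by simp
  then show ?thesis
    using u1 ray by blast
qed

text \<open>\<open>Min\<close> and \<open>Max\<close> in \<open>lambda_min\<close> and
  \<open>lambda_max\<close> have their intended meaning only on finite nonempty sets. Eigenvectors
  for distinct eigenvalues are orthogonal, so one eigenvector per eigenvalue gives an orthogonal
  family.\<close>

lemma finite_eigenvalues: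
  fixes S :: "real ^ 'n ^ 'n"
  assumes "transpose S = S"
  shows "finite (eigenvalues S)"
proof -
  have "\<forall>l\<in>eigenvalues S. \<exists>v. v \<noteq> 0 \<and> S *v v = l *\<^sub>R v"
    by (simp add: eigenvalues_def)
  then obtain v where v: "\<forall>l\<in>eigenvalues S. v l \<noteq> 0 \<and> S *v v l = l *\<^sub>R v l"
    by (rule bchoice[THEN exE])
  have orth: "v a \<bullet> v b = 0" if "a \<in> eigenvalues S" "b \<in> eigenvalues S" "a \<noteq> b" for a b
  proof -
    have "a * (v a \<bullet> v b) = b * (v a \<bullet> v b)"
      using symmetric_inner[OF assms, of "v a" "v b"] v that(1,2) by simp
    then show ?thesis
      using that(3) by simp
  qed
  have "inj_on v (eigenvalues S)"
  proof (rule inj_onI, rule ccontr)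
    fix a b assume *: "a \<in> eigenvalues S" "b \<in> eigenvalues S" "v a = v b" "a \<noteq> b"
    then have "v a \<bullet> v a = 0"
      using orth[OF *(1,2,4)] by simp
    then show False
      using v *(1) by simp
  qed
  moreover have "pairwise orthogonal (v ` eigenvalues S)"
    using orth by (auto simp: pairwise_def orthogonal_def)
  ultimately show ?thesis
    using pairwise_orthogonal_imp_finite finite_imageD by blast
qed

lemma eigenvalueI:
  assumes "norm u = 1" "S *v u = l *\<^sub>R u"
  shows "l \<in> eigenvalues S"
  using assms unfolding eigenvalues_def by (intro CollectI exI[of _ u]) auto

lemma eigenvalue_energy:
  assumes "k \<in> eigenvalues S"
  obtains v where "(S *v v) \<bullet> v = k * (norm v)\<^sup>2" "0 < (norm v)\<^sup>2"
proof -
  obtain v where "v \<noteq> 0" "S *v v = k *\<^sub>R v"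
    using assms unfolding eigenvalues_def by blast
  then show thesis
    by (intro that[of v]) (simp_all add: power2_norm_eq_inner)
qed

lemma lambda_min_eigenvector:
  fixes S :: "real ^ 'n ^ 'n"
  assumes "transpose S = S"
  obtains u where "norm u = 1" "S *v u = lambda_min S *\<^sub>R u"
    "\<And>x. lambda_min S * (norm x)\<^sup>2 \<le> (S *v x) \<bullet> x"
proof -
  obtain u l where u: "norm u = 1" "S *v u = l *\<^sub>R u" and ray: "\<And>x. l * (norm x)\<^sup>2 \<le> (S *v x) \<bullet> x"
    using ex_min_eigenvector[OF assms] by blast
  have "l \<le> k" if "k \<in> eigenvalues S" for k
  proof -
    obtain v where v: "(S *v v) \<bullet> v = k * (norm v)\<^sup>2" "0 < (norm v)\<^sup>2"
      using \<open>k \<in> eigenvalues S\<close> by (rule eigenvalue_energy)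
    show ?thesis
      by (rule mult_right_le_imp_le[OF _ v(2)]) (use ray[of v] v(1) in simp)
  qed
  then have "lambda_min S = l"
    unfolding lambda_min_def by (intro Min_eqI finite_eigenvalues assms eigenvalueI[OF u])
  then show thesis
    using that[of u] u ray by simp
qed

lemma lambda_max_eigenvector:
  fixes S :: "real ^ 'n ^ 'n"
  assumes "transpose S = S"
  obtains u where "norm u = 1" "S *v u = lambda_max S *\<^sub>R u"
    "\<And>x. (S *v x) \<bullet> x \<le> lambda_max S * (norm x)\<^sup>2"
proof -
  have neg: "(- S) *v x = - (S *v x)" for x
    by (rule bounded_bilinear.minus_left[OF bounded_bilinear_matrix_vector_mult])
  \<comment> \<open>The largest eigenvalue is minus the smallest one of the negated matrix.\<close>
  have "transpose (- S) = - S"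
    using assms by (simp add: transpose_def vec_eq_iff)
  then obtain u l where u: "norm u = 1" "- (S *v u) = l *\<^sub>R u"
      and ray0: "\<And>x. l * (norm x)\<^sup>2 \<le> - (S *v x) \<bullet> x"
    using ex_min_eigenvector[of "- S"] unfolding neg by blast
  have u2: "S *v u = (- l) *\<^sub>R u"
    using u(2) by (metis minus_minus scaleR_minus_left)
  have ray: "(S *v x) \<bullet> x \<le> - l * (norm x)\<^sup>2" for x
    using ray0[of x] by simp
  have "k \<le> - l" if "k \<in> eigenvalues S" for k
  proof -
    obtain v where v: "(S *v v) \<bullet> v = k * (norm v)\<^sup>2" "0 < (norm v)\<^sup>2"
      using \<open>k \<in> eigenvalues S\<close> by (rule eigenvalue_energy)
    show ?thesis
      by (rule mult_right_le_imp_le[OF _ v(2)]) (use ray[of v] v(1) in simp)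
  qed
  then have "lambda_max S = - l"
    unfolding lambda_max_def by (intro Max_eqI finite_eigenvalues assms eigenvalueI[OF u(1) u2])
  then show thesis
    using that[of u] u(1) u2 ray by simp
qed

lemma lambda_min_le_energy:
  "transpose S = S \<Longrightarrow> lambda_min S * (norm x)\<^sup>2 \<le> ((S :: real ^ 'n ^ 'n) *v x) \<bullet> x"
  by (rule lambda_min_eigenvector) simp_all

lemma energy_le_lambda_max:
  "transpose S = S \<Longrightarrow> ((S :: real ^ 'n ^ 'n) *v x) \<bullet> x \<le> lambda_max S * (norm x)\<^sup>2"
  by (rule lambda_max_eigenvector) simp_all

section \<open>Two-sided matrix multiplication as an operator for the trace inner product\<close>

lemma inner_matrix_mult_left:
  fixes X :: "real ^ 'n ^ 'm" and Y :: "real ^ 'k ^ 'n"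
  shows "(X ** Y) \<bullet> Z = Y \<bullet> (transpose X ** Z)"
proof -
  have "(X ** Y) \<bullet> Z = (\<Sum>i\<in>UNIV. \<Sum>j\<in>UNIV. \<Sum>k\<in>UNIV. X $ i $ k * Y $ k $ j * Z $ i $ j)"
    by (simp add: inner_vec_def matrix_matrix_mult_def sum_distrib_right)
  also have "\<dots> = (\<Sum>i\<in>UNIV. \<Sum>k\<in>UNIV. \<Sum>j\<in>UNIV. X $ i $ k * Y $ k $ j * Z $ i $ j)"
    by (intro sum.cong refl sum.swap)
  also have "\<dots> = (\<Sum>k\<in>UNIV. \<Sum>i\<in>UNIV. \<Sum>j\<in>UNIV. X $ i $ k * Y $ k $ j * Z $ i $ j)"
    by (rule sum.swap)
  also have "\<dots> = (\<Sum>k\<in>UNIV. \<Sum>j\<in>UNIV. \<Sum>i\<in>UNIV. X $ i $ k * Y $ k $ j * Z $ i $ j)"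
    by (intro sum.cong refl sum.swap)
  also have "\<dots> = Y \<bullet> (transpose X ** Z)"
    by (simp add: inner_vec_def matrix_matrix_mult_def transpose_def sum_distrib_left mult_ac)
  finally show ?thesis .
qed

lemma inner_transpose_matrix:
  fixes X Y :: "real ^ 'n ^ 'm"
  shows "transpose X \<bullet> transpose Y = X \<bullet> Y"
  unfolding inner_vec_def transpose_def by (simp add: inner_vec_def) (rule sum.swap)

lemma inner_matrix_mult_right:
  fixes X :: "real ^ 'k ^ 'n" and Y :: "real ^ 'n ^ 'm"
  shows "(Y ** X) \<bullet> Z = Y \<bullet> (Z ** transpose X)"
  using inner_matrix_mult_left[of "transpose X" "transpose Y" "transpose Z"]
  by (metis inner_transpose_matrix matrix_transpose_mul transpose_transpose)

lemma linear_sandwich: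
  fixes P :: "real ^ 'm ^ 'm" and Q :: "real ^ 'n ^ 'n"
  shows "linear (\<lambda>X. P ** X ** Q)"
proof -
  have 1: "linear (\<lambda>X :: real ^ 'n ^ 'm. P ** X)"
    by (rule linearI)
      (simp_all add: vec_eq_iff matrix_matrix_mult_def distrib_left sum.distrib sum_distrib_left mult_ac)
  have 2: "linear (\<lambda>X :: real ^ 'n ^ 'm. X ** Q)"
    by (rule linearI)
      (simp_all add: vec_eq_iff matrix_matrix_mult_def algebra_simps sum.distrib sum_distrib_left mult_ac)
  show ?thesis
    using linear_compose[OF 1 2] by (simp add: o_def)
qed

lemma sandwich_selfadjoint:
  fixes P :: "real ^ 'm ^ 'm" and Q :: "real ^ 'n ^ 'n"
  assumes "transpose P = P" "transpose Q = Q"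
  shows "(P ** X ** Q) \<bullet> Y = X \<bullet> (P ** Y ** Q)"
proof -
  have "(P ** X ** Q) \<bullet> Y = (P ** X) \<bullet> (Y ** Q)"
    by (simp add: inner_matrix_mult_right[of _ Q] assms)
  also have "\<dots> = X \<bullet> (P ** (Y ** Q))"
    by (simp add: inner_matrix_mult_left[of P] assms)
  finally show ?thesis
    by (simp only: matrix_mul_assoc)
qed

lemma sandwich_outer_product:
  fixes P :: "real ^ 'm ^ 'm" and Q :: "real ^ 'n ^ 'n"
  shows "P ** outer_product x y ** Q = outer_product (P *v x) (y v* Q)"
proof -
  have "P ** outer_product x y = outer_product (P *v x) y"
    by (simp add: vec_eq_iff matrix_matrix_mult_def matrix_vector_mult_def sum_distrib_left mult_ac)
  moreover have "outer_product z y ** Q = outer_product z (y v* Q)" for z :: "real ^ 'm"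
    by (simp add: vec_eq_iff matrix_matrix_mult_def vector_matrix_mult_def sum_distrib_left mult_ac)
  ultimately show ?thesis
    by simp
qed

section \<open>Second moments and the population risk\<close>

lemma (in pair_sigma_finite) integrable_fst_times_snd:
  fixes f :: "_ \<Rightarrow> real"
  assumes f: "integrable M1 f" and g: "integrable M2 g"
  shows "integrable (M1 \<Otimes>\<^sub>M M2) (\<lambda>z. f (fst z) * g (snd z))"
    and "(LINT z|(M1 \<Otimes>\<^sub>M M2). f (fst z) * g (snd z)) = integral\<^sup>L M1 f * integral\<^sup>L M2 g"
proof -
  have [measurable]: "f \<in> borel_measurable M1" "g \<in> borel_measurable M2"
    using f g by auto
  show int: "integrable (M1 \<Otimes>\<^sub>M M2) (\<lambda>z. f (fst z) * g (snd z))"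
    by (rule Fubini_integrable) (use f g in \<open>simp_all add: abs_mult\<close>)
  show "(LINT z|(M1 \<Otimes>\<^sub>M M2). f (fst z) * g (snd z)) = integral\<^sup>L M1 f * integral\<^sup>L M2 g"
    using integral_fst'[OF int] by simp
qed

lemma P4_prob_space: "\<mu> \<in> P4 \<Longrightarrow> prob_space \<mu>"
  and P4_sets: "\<mu> \<in> P4 \<Longrightarrow> sets \<mu> = sets borel"
  by (simp_all add: P4_def)

lemma P4_integrable_norm2:
  assumes "\<mu> \<in> P4"
  shows "integrable \<mu> (\<lambda>x. (norm x)\<^sup>2)"
proof -
  interpret prob_space \<mu> using assms by (rule P4_prob_space)
  have [measurable_cong]: "sets \<mu> = sets borel" using assms by (rule P4_sets)
  have "integrable \<mu> (\<lambda>x. (norm x) ^ 4)"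
    using assms by (simp add: P4_def)
  then have "integrable \<mu> (\<lambda>x. ((norm x)\<^sup>2)\<^sup>2)"
    by simp
  then show ?thesis
    by (rule square_integrable_imp_integrable[rotated]) measurable
qed

lemma P4_integrable_components:
  fixes \<mu> :: "(real ^ 'n) measure"
  assumes "\<mu> \<in> P4"
  shows "integrable \<mu> (\<lambda>x. x $ i * x $ j)"
proof (rule Bochner_Integration.integrable_bound[OF P4_integrable_norm2[OF assms]])
  have [measurable_cong]: "sets \<mu> = sets borel" using assms by (rule P4_sets)
  show "(\<lambda>x. x $ i * x $ j) \<in> borel_measurable \<mu>"
    by measurable
  show "AE x in \<mu>. norm (x $ i * x $ j) \<le> norm ((norm x)\<^sup>2)"
    by (auto simp: abs_mult power2_eq_square intro!: mult_mono component_le_norm_cart)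
qed

lemma second_moment_quadratic:
  fixes \<mu> :: "(real ^ 'n) measure"
  assumes "\<mu> \<in> P4"
  shows "integrable \<mu> (\<lambda>x. x \<bullet> (G *v x))"
    and "(LINT x|\<mu>. x \<bullet> (G *v x)) = G \<bullet> second_moment \<mu>"
proof -
  have eq: "x \<bullet> (G *v x) = (\<Sum>i\<in>UNIV. \<Sum>j\<in>UNIV. G $ i $ j * (x $ i * x $ j))" for x
    by (simp add: inner_vec_def matrix_vector_mult_def sum_distrib_left mult_ac)
  show "integrable \<mu> (\<lambda>x. x \<bullet> (G *v x))"
    unfolding eq by (intro Bochner_Integration.integrable_sum integrable_mult_right
        P4_integrable_components assms)
  show "(LINT x|\<mu>. x \<bullet> (G *v x)) = G \<bullet> second_moment \<mu>"
    unfolding eq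
    by (simp add: Bochner_Integration.integral_sum Bochner_Integration.integrable_sum
        integrable_mult_right P4_integrable_components assms inner_vec_def second_moment_def)
qed

lemma transpose_second_moment: "transpose (second_moment \<mu>) = second_moment \<mu>"
  by (simp add: transpose_def second_moment_def vec_eq_iff mult.commute)

lemma inner_matrix_vector_mult_transpose:
  "((X :: real ^ 'n ^ 'm) *v x) \<bullet> y = x \<bullet> (transpose X *v y)"
  by (metis dot_lmul_matrix inner_commute transpose_matrix_vector)

text \<open>Writing the form as an average of \<open>P\<close>-energies of the vectors
  \<open>X *v x\<close> allows spectral bounds on \<open>P\<close> to be applied pointwise under the
  integral.\<close>

lemma second_moment_sandwich:
  fixes \<mu> :: "(real ^ 'n) measure" and X :: "real ^ 'n ^ 'm"
  assumes "\<mu> \<in> P4"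
  shows "integrable \<mu> (\<lambda>x. (X *v x) \<bullet> (P *v (X *v x)))"
    and "(LINT x|\<mu>. (X *v x) \<bullet> (P *v (X *v x))) = (P ** X ** second_moment \<mu>) \<bullet> X"
proof -
  have eq: "(X *v x) \<bullet> (P *v (X *v x)) = x \<bullet> ((transpose X ** (P ** X)) *v x)" for x
    by (simp add: inner_matrix_vector_mult_transpose matrix_vector_mul_assoc matrix_mul_assoc)
  have "(transpose X ** (P ** X)) \<bullet> second_moment \<mu> = (P ** X) \<bullet> (X ** second_moment \<mu>)"
    using inner_matrix_mult_left[of "transpose X" "P ** X"] by simp
  also have "\<dots> = (P ** X ** second_moment \<mu>) \<bullet> X"
    using inner_matrix_mult_right[of "P ** X" "second_moment \<mu>" X] by (simp add: transpose_second_moment)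
  finally show "integrable \<mu> (\<lambda>x. (X *v x) \<bullet> (P *v (X *v x)))"
    "(LINT x|\<mu>. (X *v x) \<bullet> (P *v (X *v x))) = (P ** X ** second_moment \<mu>) \<bullet> X"
    unfolding eq by (simp_all add: second_moment_quadratic assms)
qed

lemma second_moment_dot:
  fixes \<mu> :: "(real ^ 'n) measure"
  assumes "\<mu> \<in> P4"
  shows "integrable \<mu> (\<lambda>x. (w \<bullet> x)\<^sup>2)"
    and "(LINT x|\<mu>. (w \<bullet> x)\<^sup>2) = w \<bullet> (second_moment \<mu> *v w)"
proof -
  have eq: "(w \<bullet> x)\<^sup>2 = x \<bullet> (outer_product w w *v x)" for x
    by (simp add: outer_product_mult_vec inner_commute power2_eq_square)
  show "integrable \<mu> (\<lambda>x. (w \<bullet> x)\<^sup>2)"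
    "(LINT x|\<mu>. (w \<bullet> x)\<^sup>2) = w \<bullet> (second_moment \<mu> *v w)"
    unfolding eq
    by (simp_all add: second_moment_quadratic assms inner_outer_product
        inner_commute[of "outer_product w w"])
qed

lemma lambda_min_second_moment_nonneg:
  assumes "\<mu> \<in> P4"
  shows "0 \<le> lambda_min (second_moment \<mu>)"
proof -
  obtain u where u: "norm u = 1" "second_moment \<mu> *v u = lambda_min (second_moment \<mu>) *\<^sub>R u"
    by (rule lambda_min_eigenvector[OF transpose_second_moment[of \<mu>]])
  have "lambda_min (second_moment \<mu>) = u \<bullet> (second_moment \<mu> *v u)"
    using u by (simp add: norm_eq_1)
  also have "\<dots> = (LINT x|\<mu>. (u \<bullet> x)\<^sup>2)"
    by (simp add: second_moment_dot assms)
  finally show ?thesis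
    by simp
qed

lemma inner_matrix_mult_symmetric:
  fixes X :: "real ^ 'n ^ 'm" and S :: "real ^ 'n ^ 'n"
  assumes "transpose S = S"
  shows "(X ** S) \<bullet> X = (\<Sum>i\<in>UNIV. (S *v (X $ i)) \<bullet> (X $ i))"
proof -
  have "(X ** S) $ i = S *v (X $ i)" for i
  proof -
    have "S $ a $ b = S $ b $ a" for a b
      using assms by (metis transpose_def vec_lambda_beta)
    then show ?thesis
      by (simp add: vec_eq_iff matrix_matrix_mult_def matrix_vector_mult_def mult.commute)
  qed
  then show ?thesis
    by (simp add: inner_vec_def[of "X ** S"])
qed

lemma norm_matrix_rows: "(norm (X :: real ^ 'n ^ 'm))\<^sup>2 = (\<Sum>i\<in>UNIV. (norm (X $ i))\<^sup>2)"
  by (simp add: power2_norm_eq_inner inner_vec_def[of X])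

text \<open>The bounds for \<open>S1\<close> are applied under the integral and those for
  \<open>S2\<close> to each row of \<open>X\<close>, so no simultaneous diagonalization is involved.
  The lower constant is the coercivity constant of the locale, and the ratio of the two is the
  product of the condition numbers.\<close>

lemma second_moment_sandwich_bounds:
  fixes \<mu> :: "(real ^ 'm) measure" and \<nu> :: "(real ^ 'n) measure"
  assumes \<mu>: "\<mu> \<in> P4" and \<nu>: "\<nu> \<in> P4"
  defines "S1 \<equiv> second_moment \<mu>" and "S2 \<equiv> second_moment \<nu>"
  shows "lambda_min S1 * lambda_min S2 * (norm X)\<^sup>2 \<le> (S1 ** X ** S2) \<bullet> X"
    and "(S1 ** X ** S2) \<bullet> X \<le> lambda_max S1 * lambda_max S2 * (norm X)\<^sup>2"
proof -
  note sym = transpose_second_moment[of \<mu>, folded S1_def] transpose_second_moment[of \<nu>, folded S2_def]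
  note min1 = lambda_min_le_energy[OF sym(1)] and min2 = lambda_min_le_energy[OF sym(2)]
    and max1 = energy_le_lambda_max[OF sym(1)] and max2 = energy_le_lambda_max[OF sym(2)]
  have nonneg: "0 \<le> lambda_min S1"
    unfolding S1_def using \<mu> by (rule lambda_min_second_moment_nonneg)
  \<comment> \<open>Any unit vector shows that \<open>lambda_max S1\<close> is at least
    \<open>lambda_min S1\<close>, hence nonnegative.\<close>
  obtain u where u: "norm u = 1" "S1 *v u = lambda_max S1 *\<^sub>R u"
    by (rule lambda_max_eigenvector[OF sym(1)])
  have nonneg': "0 \<le> lambda_max S1"
    using min1[of u] max1[of u] nonneg u(1) by simp
  note sw = second_moment_sandwich[OF \<nu>, of X, folded S2_def]
  \<comment> \<open>With the identity for \<open>P\<close>, the average squared length of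
    \<open>X *v x\<close> becomes a form in \<open>S2\<close> alone.\<close>
  have id: "(LINT x|\<nu>. (X *v x) \<bullet> (X *v x)) = (X ** S2) \<bullet> X"
    "integrable \<nu> (\<lambda>x. (X *v x) \<bullet> (X *v x))"
    using sw[of "mat 1"] by simp_all
  have "lambda_min S1 * lambda_min S2 * (norm X)\<^sup>2 \<le> lambda_min S1 * ((X ** S2) \<bullet> X)"
    unfolding mult.assoc inner_matrix_mult_symmetric[OF sym(2)] norm_matrix_rows sum_distrib_left[of "lambda_min S2"]
    by (intro mult_left_mono sum_mono min2 nonneg)
  also have "\<dots> = (LINT x|\<nu>. lambda_min S1 * ((X *v x) \<bullet> (X *v x)))"
    by (simp add: id)
  also have "\<dots> \<le> (LINT x|\<nu>. (X *v x) \<bullet> (S1 *v (X *v x)))"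
    by (intro integral_mono integrable_mult_right id sw)
      (use min1 in \<open>simp add: power2_norm_eq_inner inner_commute\<close>)
  finally show "lambda_min S1 * lambda_min S2 * (norm X)\<^sup>2 \<le> (S1 ** X ** S2) \<bullet> X"
    by (simp add: sw)
  have "(S1 ** X ** S2) \<bullet> X = (LINT x|\<nu>. (X *v x) \<bullet> (S1 *v (X *v x)))"
    by (simp add: sw)
  also have "\<dots> \<le> (LINT x|\<nu>. lambda_max S1 * ((X *v x) \<bullet> (X *v x)))"
    by (intro integral_mono integrable_mult_right id sw)
      (use max1 in \<open>simp add: power2_norm_eq_inner inner_commute\<close>)
  also have "\<dots> = lambda_max S1 * ((X ** S2) \<bullet> X)"
    by (simp add: id)
  also have "\<dots> \<le> lambda_max S1 * lambda_max S2 * (norm X)\<^sup>2"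
    unfolding mult.assoc inner_matrix_mult_symmetric[OF sym(2)] norm_matrix_rows sum_distrib_left[of "lambda_max S2"]
    by (intro mult_left_mono sum_mono max2 nonneg')
  finally show "(S1 ** X ** S2) \<bullet> X \<le> lambda_max S1 * lambda_max S2 * (norm X)\<^sup>2" .
qed

section \<open>From conditional laws to the population risk\<close>

lemma joint_law_additive_noise:
  fixes Q :: "'a::euclidean_space measure"
  assumes Q: "prob_space Q" "sets Q = sets borel" and N: "prob_space N" "sets N = sets borel"
    and g: "g \<in> borel_measurable borel"
  shows "joint_law Q (\<lambda>x. distr N borel (\<lambda>n. g x + n)) =
    distr (Q \<Otimes>\<^sub>M N) borel (\<lambda>z. (fst z, g (fst z) + snd z))"
proof -
  interpret Q: prob_space Q by fact
  interpret N: prob_space N by fact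
  interpret QN: pair_prob_space Q N ..
  note [measurable_cong] = Q(2) N(2)
  note [measurable] = g
  let ?F = "\<lambda>z. (fst z, g (fst z) + snd z)"
  have F: "?F \<in> measurable (Q \<Otimes>\<^sub>M N) borel"
    unfolding borel_prod[symmetric] by measurable
  have N_in: "N \<in> space (subprob_algebra N)"
    by (rule N.M_in_subprob)
  have kernel: "(\<lambda>x. distr N (Q \<Otimes>\<^sub>M N) (Pair x)) \<in> measurable Q (subprob_algebra (Q \<Otimes>\<^sub>M N))"
    by (rule measurable_distr2[where M = N]) (use N_in in auto)
  \<comment> \<open>Once the product measure is also a bind over \<open>Q\<close>, taking images
    commutes with bind and only the kernels at a fixed \<open>x\<close> need comparing.\<close>
  have bind: "Q \<Otimes>\<^sub>M N = Q \<bind> (\<lambda>x. distr N (Q \<Otimes>\<^sub>M N) (Pair x))"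
    by (subst QN.pair_measure_eq_bind, intro bind_cong refl bind_return_distr') (auto simp: N.not_empty)
  have "distr (Q \<Otimes>\<^sub>M N) borel ?F = Q \<bind> (\<lambda>x. distr (distr N (Q \<Otimes>\<^sub>M N) (Pair x)) borel ?F)"
    by (subst bind, rule distr_bind[OF kernel Q.not_empty F])
  also have "\<dots> = Q \<bind> (\<lambda>x. distr (distr N borel (\<lambda>n. g x + n)) borel (\<lambda>y. (x, y)))"
  proof (intro bind_cong refl)
    fix x assume x: "x \<in> space Q"
    have "distr (distr N (Q \<Otimes>\<^sub>M N) (Pair x)) borel ?F = distr N borel (?F \<circ> Pair x)"
      using x by (intro distr_distr F) simp
    moreover have "(\<lambda>y. (x, y)) \<in> borel_measurable (borel :: real measure)"
      unfolding borel_prod[symmetric] by measurable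
    then have "distr (distr N borel (\<lambda>n. g x + n)) borel (\<lambda>y. (x, y)) =
        distr N borel ((\<lambda>y. (x, y)) \<circ> (\<lambda>n. g x + n))"
      by (intro distr_distr) measurable
    ultimately show "distr (distr N (Q \<Otimes>\<^sub>M N) (Pair x)) borel ?F =
        distr (distr N borel (\<lambda>n. g x + n)) borel (\<lambda>y. (x, y))"
      by (simp add: o_def)
  qed
  finally show ?thesis
    by (simp add: joint_law_def)
qed

text \<open>Integrating the second feature first leaves the \<open>\<nu>\<close>-energy of
  \<open>transpose X *v x\<close>; averaging that over the first feature is again a sandwich form.
  The product structure enters through Fubini, and the integrability through domination by a product
  of squared norms.\<close>

lemma bilinear_form_second_moment:
  fixes \<mu> :: "(real ^ 'm) measure" and \<nu> :: "(real ^ 'n) measure"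
  assumes \<mu>: "\<mu> \<in> P4" and \<nu>: "\<nu> \<in> P4"
  shows "integrable (\<mu> \<Otimes>\<^sub>M \<nu>) (\<lambda>x. (fst x \<bullet> (X *v snd x))\<^sup>2)"
    and "(LINT x|(\<mu> \<Otimes>\<^sub>M \<nu>). (fst x \<bullet> (X *v snd x))\<^sup>2) = (second_moment \<mu> ** X ** second_moment \<nu>) \<bullet> X"
proof -
  interpret \<mu>: prob_space \<mu> using \<mu> by (rule P4_prob_space)
  interpret \<nu>: prob_space \<nu> using \<nu> by (rule P4_prob_space)
  interpret pair_prob_space \<mu> \<nu> ..
  note [measurable_cong] = P4_sets[OF \<mu>] P4_sets[OF \<nu>]
  obtain B where B: "\<And>x. norm (X *v x) \<le> norm x * B"
    using bounded_linear.bounded[OF matrix_vector_mul_bounded_linear[of X]] by blast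
  have meas: "(\<lambda>x. (fst x \<bullet> (X *v snd x))\<^sup>2) \<in> borel_measurable (\<mu> \<Otimes>\<^sub>M \<nu>)"
    using borel_measurable_continuous_onI[OF linear_continuous_on[OF matrix_vector_mul_bounded_linear[of X]]]
    by measurable
  have "integrable (\<mu> \<Otimes>\<^sub>M \<nu>) (\<lambda>x. (norm (fst x))\<^sup>2 * (B\<^sup>2 * (norm (snd x))\<^sup>2))"
    by (intro integrable_fst_times_snd P4_integrable_norm2 integrable_mult_right \<mu> \<nu>)
  then show int: "integrable (\<mu> \<Otimes>\<^sub>M \<nu>) (\<lambda>x. (fst x \<bullet> (X *v snd x))\<^sup>2)"
  proof (rule Bochner_Integration.integrable_bound[OF _ meas], intro AE_I2)
    fix x :: "(real ^ 'm) \<times> (real ^ 'n)"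
    have "\<bar>fst x \<bullet> (X *v snd x)\<bar> \<le> norm (fst x) * norm (X *v snd x)"
      by (rule Cauchy_Schwarz_ineq2)
    also have "\<dots> \<le> norm (fst x) * (norm (snd x) * B)"
      by (intro mult_left_mono B) simp
    finally have "\<bar>fst x \<bullet> (X *v snd x)\<bar>\<^sup>2 \<le> (norm (fst x) * (norm (snd x) * B))\<^sup>2"
      by (intro power_mono) simp_all
    then show "norm ((fst x \<bullet> (X *v snd x))\<^sup>2) \<le> norm ((norm (fst x))\<^sup>2 * (B\<^sup>2 * (norm (snd x))\<^sup>2))"
      by (simp add: power_mult_distrib mult_ac)
  qed
  have "(LINT x|(\<mu> \<Otimes>\<^sub>M \<nu>). (fst x \<bullet> (X *v snd x))\<^sup>2) = (LINT x|\<mu>. (LINT y|\<nu>. (x \<bullet> (X *v y))\<^sup>2))"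
    using integral_fst'[OF int] by simp
  also have "\<dots> = (LINT x|\<mu>. (transpose X *v x) \<bullet> (second_moment \<nu> *v (transpose X *v x)))"
  proof (intro Bochner_Integration.integral_cong refl)
    fix x
    have "x \<bullet> (X *v y) = (transpose X *v x) \<bullet> y" for y
      by (metis inner_commute inner_matrix_vector_mult_transpose)
    then show "(LINT y|\<nu>. (x \<bullet> (X *v y))\<^sup>2) =
        (transpose X *v x) \<bullet> (second_moment \<nu> *v (transpose X *v x))"
      by (simp add: second_moment_dot[OF \<nu>])
  qed
  also have "\<dots> = (second_moment \<nu> ** transpose X ** second_moment \<mu>) \<bullet> transpose X"
    by (rule second_moment_sandwich[OF \<mu>])
  also have "\<dots> = transpose (second_moment \<mu> ** X ** second_moment \<nu>) \<bullet> transpose X"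
    by (simp add: matrix_transpose_mul transpose_second_moment matrix_mul_assoc)
  also have "\<dots> = (second_moment \<mu> ** X ** second_moment \<nu>) \<bullet> X"
    by (rule inner_transpose_matrix)
  finally show "(LINT x|(\<mu> \<Otimes>\<^sub>M \<nu>). (fst x \<bullet> (X *v snd x))\<^sup>2) =
      (second_moment \<mu> ** X ** second_moment \<nu>) \<bullet> X" .
qed

text \<open>The residual is the bilinear form in \<open>M - M0\<close> minus the noise. The cross
  term factors over the product measure and vanishes with the noise mean, so the noise contributes
  only a constant.\<close>

lemma bilinear_risk_additive_noise:
  fixes \<mu> :: "(real ^ 'm) measure" and \<nu> :: "(real ^ 'n) measure" and N :: "real measure"
  assumes \<mu>: "\<mu> \<in> P4" and \<nu>: "\<nu> \<in> P4"
    and N: "prob_space N" "sets N = sets borel" "integrable N (\<lambda>n. n)" "(LINT n|N. n) = 0"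
      "integrable N (\<lambda>n. n\<^sup>2)"
  shows "bilinear_risk (distr ((\<mu> \<Otimes>\<^sub>M \<nu>) \<Otimes>\<^sub>M N) borel
      (\<lambda>z. (fst z, fst (fst z) \<bullet> (M0 *v snd (fst z)) + snd z))) M =
    (LINT n|N. n\<^sup>2) / 2 + (second_moment \<mu> ** (M - M0) ** second_moment \<nu>) \<bullet> (M - M0) / 2"
proof -
  interpret \<mu>: prob_space \<mu> using \<mu> by (rule P4_prob_space)
  interpret \<nu>: prob_space \<nu> using \<nu> by (rule P4_prob_space)
  interpret Q: pair_prob_space \<mu> \<nu> ..
  interpret N: prob_space N by fact
  interpret QN: pair_prob_space "\<mu> \<Otimes>\<^sub>M \<nu>" N ..
  note [measurable_cong] = P4_sets[OF \<mu>] P4_sets[OF \<nu>] N(2)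
  have [measurable]: "(\<lambda>x. X *v x) \<in> borel_measurable borel" for X :: "real ^ 'n ^ 'm"
    by (intro borel_measurable_continuous_onI linear_continuous_on matrix_vector_mul_bounded_linear)
  define a where "a x = fst x \<bullet> ((M - M0) *v snd x)" for x :: "(real ^ 'm) \<times> (real ^ 'n)"
  have [measurable]: "a \<in> borel_measurable (\<mu> \<Otimes>\<^sub>M \<nu>)"
    unfolding a_def[abs_def] by measurable
  have a2: "integrable (\<mu> \<Otimes>\<^sub>M \<nu>) (\<lambda>x. (a x)\<^sup>2)"
    unfolding a_def by (rule bilinear_form_second_moment[OF \<mu> \<nu>])
  then have a1: "integrable (\<mu> \<Otimes>\<^sub>M \<nu>) a"
    by (rule Q.square_integrable_imp_integrable[rotated]) measurable
  note prod = QN.integrable_fst_times_snd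
  have i1: "integrable ((\<mu> \<Otimes>\<^sub>M \<nu>) \<Otimes>\<^sub>M N) (\<lambda>z. (a (fst z))\<^sup>2)"
    "(LINT z|((\<mu> \<Otimes>\<^sub>M \<nu>) \<Otimes>\<^sub>M N). (a (fst z))\<^sup>2) = (LINT x|(\<mu> \<Otimes>\<^sub>M \<nu>). (a x)\<^sup>2)"
    using prod[OF a2, of "\<lambda>_. 1"] by (simp_all add: N.prob_space)
  have i2: "integrable ((\<mu> \<Otimes>\<^sub>M \<nu>) \<Otimes>\<^sub>M N) (\<lambda>z. a (fst z) * snd z)"
    "(LINT z|((\<mu> \<Otimes>\<^sub>M \<nu>) \<Otimes>\<^sub>M N). a (fst z) * snd z) = 0"
    using prod[OF a1 N(3)] N(4) by simp_all
  have i3: "integrable ((\<mu> \<Otimes>\<^sub>M \<nu>) \<Otimes>\<^sub>M N) (\<lambda>z. (snd z)\<^sup>2)"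
    "(LINT z|((\<mu> \<Otimes>\<^sub>M \<nu>) \<Otimes>\<^sub>M N). (snd z)\<^sup>2) = (LINT n|N. n\<^sup>2)"
    using prod[OF _ N(5), of "\<lambda>_. 1"] by (simp_all add: Q.prob_space)
  let ?F = "\<lambda>z. (fst z, fst (fst z) \<bullet> (M0 *v snd (fst z)) + snd z)"
  let ?l = "\<lambda>z. case z of ((x1, x2), y) \<Rightarrow> (x1 \<bullet> (M *v x2) - y)\<^sup>2 / 2"
  have F: "?F \<in> measurable ((\<mu> \<Otimes>\<^sub>M \<nu>) \<Otimes>\<^sub>M N) borel"
    unfolding borel_prod[symmetric] by measurable
  have l: "?l \<in> borel_measurable (borel :: (((real ^ 'm) \<times> (real ^ 'n)) \<times> real) measure)"
    unfolding borel_prod[symmetric] case_prod_beta by measurable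
  have "bilinear_risk (distr ((\<mu> \<Otimes>\<^sub>M \<nu>) \<Otimes>\<^sub>M N) borel ?F) M =
      (LINT z|((\<mu> \<Otimes>\<^sub>M \<nu>) \<Otimes>\<^sub>M N). ?l (?F z))"
    unfolding bilinear_risk_def by (rule integral_distr[OF F l])
  also have "\<dots> = (LINT z|((\<mu> \<Otimes>\<^sub>M \<nu>) \<Otimes>\<^sub>M N). (a (fst z))\<^sup>2 / 2 - a (fst z) * snd z + (snd z)\<^sup>2 / 2)"
  proof (intro Bochner_Integration.integral_cong refl)
    fix z :: "((real ^ 'm) \<times> (real ^ 'n)) \<times> real"
    have "a (fst z) = fst (fst z) \<bullet> (M *v snd (fst z)) - fst (fst z) \<bullet> (M0 *v snd (fst z))"
      by (simp add: a_def matrix_vector_mult_diff_rdistrib inner_diff_right)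
    moreover have "(p - (q + s))\<^sup>2 / 2 = (p - q)\<^sup>2 / 2 - (p - q) * s + s\<^sup>2 / 2" for p q s :: real
      by (simp add: power2_eq_square field_simps)
    ultimately show "?l (?F z) = (a (fst z))\<^sup>2 / 2 - a (fst z) * snd z + (snd z)\<^sup>2 / 2"
      by (simp add: case_prod_beta)
  qed
  also have "\<dots> = (LINT x|(\<mu> \<Otimes>\<^sub>M \<nu>). (a x)\<^sup>2) / 2 + (LINT n|N. n\<^sup>2) / 2"
    using i1 i2 i3 by simp
  finally show ?thesis
    unfolding a_def bilinear_form_second_moment(2)[OF \<mu> \<nu>] by simp
qed

section \<open>Wasserstein distance to singular second moments\<close>

lemma ennreal_sqrt_ennreal: "0 \<le> r \<Longrightarrow> ennreal_sqrt (ennreal r) = ennreal (sqrt r)"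
  by (simp add: ennreal_sqrt_def)

lemma ennreal_le_ennreal_sqrt: "ennreal r \<le> a \<Longrightarrow> ennreal (sqrt r) \<le> ennreal_sqrt a"
  by (cases a; cases "0 \<le> r")
    (auto simp: ennreal_sqrt_def ennreal_le_iff2 intro!: ennreal_leI real_sqrt_le_mono)

text \<open>Under any coupling the second point lies almost surely in the hyperplane orthogonal to
  \<open>w\<close>, so Cauchy-Schwarz gives a pointwise bound on the cost that involves the first
  marginal only.\<close>

lemma W2_ge:
  fixes Q Q' :: "'a::euclidean_space measure"
  assumes w: "norm w \<le> 1" and Q': "AE x in Q'. w \<bullet> x = 0"
    and r: "ennreal r \<le> (\<integral>\<^sup>+ x. ennreal ((w \<bullet> x)\<^sup>2) \<partial>Q)"
  shows "ennreal (sqrt r) \<le> W2 Q Q'"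
  unfolding W2_def
proof (intro INF_greatest ennreal_le_ennreal_sqrt)
  fix \<pi> assume "\<pi> \<in> couplings Q Q'"
  then have \<pi>: "sets \<pi> = sets borel" "distr \<pi> borel fst = Q" "distr \<pi> borel snd = Q'"
    by (auto simp: couplings_def)
  have [measurable_cong]: "sets \<pi> = sets (borel \<Otimes>\<^sub>M (borel :: 'a measure) :: ('a \<times> 'a) measure)"
    unfolding borel_prod by (rule \<pi>(1))
  have snd: "AE z in \<pi>. w \<bullet> snd z = 0"
    using Q' unfolding \<pi>(3)[symmetric] by (rule AE_distrD[rotated]) measurable
  note r
  also have "(\<integral>\<^sup>+ x. ennreal ((w \<bullet> x)\<^sup>2) \<partial>Q) = (\<integral>\<^sup>+ z. ennreal ((w \<bullet> fst z)\<^sup>2) \<partial>\<pi>)"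
    unfolding \<pi>(2)[symmetric] by (rule nn_integral_distr) measurable
  also have "\<dots> \<le> (\<integral>\<^sup>+ z. ennreal ((norm (fst z - snd z))\<^sup>2) \<partial>\<pi>)"
  proof (rule nn_integral_mono_AE)
    show "AE z in \<pi>. ennreal ((w \<bullet> fst z)\<^sup>2) \<le> ennreal ((norm (fst z - snd z))\<^sup>2)"
      using snd
    proof eventually_elim
      case (elim z)
      have "\<bar>w \<bullet> fst z\<bar> = \<bar>w \<bullet> (fst z - snd z)\<bar>"
        using elim by (simp add: inner_diff_right)
      also have "\<dots> \<le> norm w * norm (fst z - snd z)"
        by (rule Cauchy_Schwarz_ineq2)
      also have "\<dots> \<le> 1 * norm (fst z - snd z)"
        using w by (intro mult_right_mono) auto
      finally have "\<bar>w \<bullet> fst z\<bar>\<^sup>2 \<le> (norm (fst z - snd z))\<^sup>2"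
        by (intro power_mono) simp_all
      then show ?case
        by (intro ennreal_leI) simp
    qed
  qed
  finally show "ennreal r \<le> (\<integral>\<^sup>+ z. ennreal ((norm (fst z - snd z))\<^sup>2) \<partial>\<pi>)" .
qed

text \<open>The bound is the cost of the deterministic coupling that sends \<open>x\<close> to
  \<open>(x, T x)\<close>.\<close>

lemma W2_distr_le:
  fixes Q :: "'a::euclidean_space measure"
  assumes Q: "prob_space Q" "sets Q = sets borel" and T: "T \<in> borel_measurable borel"
  shows "W2 Q (distr Q borel T) \<le> ennreal_sqrt (\<integral>\<^sup>+ x. ennreal ((norm (x - T x))\<^sup>2) \<partial>Q)"
proof -
  interpret prob_space Q by fact
  note [measurable_cong] = Q(2) and [measurable] = T
  have pair: "(\<lambda>x. (x, T x)) \<in> measurable Q borel"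
    unfolding borel_prod[symmetric] by measurable
  have [measurable]: "fst \<in> measurable (borel :: ('a \<times> 'a) measure) borel"
    "snd \<in> measurable (borel :: ('a \<times> 'a) measure) borel"
    by (auto intro!: borel_measurable_continuous_onI continuous_intros)
  let ?\<pi> = "distr Q borel (\<lambda>x. (x, T x))"
  have "distr ?\<pi> borel fst = Q" "distr ?\<pi> borel snd = distr Q borel T"
    using pair Q(2) by (simp_all add: distr_distr o_def distr_id2)
  then have "?\<pi> \<in> couplings Q (distr Q borel T)"
    unfolding couplings_def using pair by (simp add: prob_space_distr)
  then have "W2 Q (distr Q borel T) \<le>
      ennreal_sqrt (\<integral>\<^sup>+ z. ennreal ((norm (fst z - snd z))\<^sup>2) \<partial>?\<pi>)"
    unfolding W2_def by (rule INF_lower)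
  also have "(\<integral>\<^sup>+ z. ennreal ((norm (fst z - snd z))\<^sup>2) \<partial>?\<pi>) =
      (\<integral>\<^sup>+ x. ennreal ((norm (x - T x))\<^sup>2) \<partial>Q)"
    using pair by (subst nn_integral_distr) simp_all
  finally show ?thesis .
qed

lemma nn_integral_pair_fst:
  assumes "prob_space N" and f: "f \<in> borel_measurable M"
  shows "(\<integral>\<^sup>+ z. f (fst z) \<partial>(M \<Otimes>\<^sub>M N)) = (\<integral>\<^sup>+ x. f x \<partial>M)"
proof -
  interpret prob_space N by fact
  show ?thesis
    using nn_integral_fst[of "\<lambda>z. f (fst z)" M] f by (simp add: emeasure_space_1)
qed

lemma nn_integral_pair_snd:
  assumes "prob_space M" "prob_space N" and f: "f \<in> borel_measurable N"
  shows "(\<integral>\<^sup>+ z. f (snd z) \<partial>(M \<Otimes>\<^sub>M N)) = (\<integral>\<^sup>+ x. f x \<partial>N)"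
proof -
  interpret N: prob_space N by fact
  interpret M: prob_space M by fact
  show ?thesis
    using N.nn_integral_fst[of "\<lambda>z. f (snd z)" M] f by (simp add: M.emeasure_space_1)
qed

lemma nn_integral_second_moment:
  fixes \<mu> :: "(real ^ 'n) measure"
  assumes "\<mu> \<in> P4"
  shows "(\<integral>\<^sup>+ x. ennreal ((w \<bullet> x)\<^sup>2) \<partial>\<mu>) = ennreal ((second_moment \<mu> *v w) \<bullet> w)"
  using second_moment_dot[OF assms, of w] by (subst nn_integral_eq_integral) (simp_all add: inner_commute)

text \<open>Projecting out the direction \<open>u\<close> makes the second moment singular at the least transport cost.\<close>

definition project_out :: "'a::real_inner \<Rightarrow> 'a \<Rightarrow> 'a" where
  "project_out u x = x - (u \<bullet> x) *\<^sub>R u"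

lemma measurable_project_out [measurable]:
  "project_out u \<in> borel_measurable (borel :: 'a::euclidean_space measure)"
  unfolding project_out_def by measurable

text \<open>The exceptional set contains only laws with finite fourth moment, so the projected law
  must be shown to remain a competitor.\<close>

lemma P4_project_out:
  fixes \<mu> :: "'a::euclidean_space measure"
  assumes \<mu>: "\<mu> \<in> P4" and u: "norm u = 1"
  shows "distr \<mu> borel (project_out u) \<in> P4"
proof -
  interpret prob_space \<mu> using \<mu> by (rule P4_prob_space)
  have [measurable_cong]: "sets \<mu> = sets borel" using \<mu> by (rule P4_sets)
  have "norm (project_out u x) \<le> 2 * norm x" for x
  proof -
    have "norm (project_out u x) \<le> norm x + \<bar>u \<bullet> x\<bar> * norm u"
      unfolding project_out_def using norm_triangle_ineq4[of x "(u \<bullet> x) *\<^sub>R u"] by simp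
    then show ?thesis
      using Cauchy_Schwarz_ineq2[of u x] u by simp
  qed
  then have bound: "norm (project_out u x) ^ 4 \<le> 16 * norm x ^ 4" for x
    using power_mono[of "norm (project_out u x)" "2 * norm x" 4] by (simp add: power_mult_distrib)
  have "integrable \<mu> (\<lambda>x. 16 * norm x ^ 4)"
    using \<mu> by (intro integrable_mult_right) (simp add: P4_def)
  then have "integrable \<mu> (\<lambda>x. norm (project_out u x) ^ 4)"
    by (rule Bochner_Integration.integrable_bound) (use bound in \<open>simp_all, measurable\<close>)
  then show ?thesis
    by (simp add: P4_def prob_space_distr integrable_distr_eq)
qed

lemma lambda_min_project_out:
  fixes \<mu> :: "(real ^ 'n) measure"
  assumes \<mu>: "\<mu> \<in> P4" and u: "norm u = 1"
  shows "lambda_min (second_moment (distr \<mu> borel (project_out u))) = 0"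
proof -
  let ?\<mu> = "distr \<mu> borel (project_out u)"
  have [measurable_cong]: "sets \<mu> = sets borel" using \<mu> by (rule P4_sets)
  have P4: "?\<mu> \<in> P4"
    by (rule P4_project_out) fact+
  have "lambda_min (second_moment ?\<mu>) * (norm u)\<^sup>2 \<le> (second_moment ?\<mu> *v u) \<bullet> u"
    by (rule lambda_min_le_energy[OF transpose_second_moment])
  also have "\<dots> = (LINT x|?\<mu>. (u \<bullet> x)\<^sup>2)"
    unfolding second_moment_dot(2)[OF P4] by (rule inner_commute)
  also have "\<dots> = (LINT x|\<mu>. (u \<bullet> project_out u x)\<^sup>2)"
    by (rule integral_distr) measurable
  also have "\<dots> = 0"
    using u by (simp add: project_out_def inner_diff_right norm_eq_1)
  finally show ?thesis
    using lambda_min_second_moment_nonneg[OF P4] u by simp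
qed

text \<open>A direction lying in one factor is removed from that factor alone, so the image is still
  a product law, as membership in the permissible set requires.\<close>

lemma distr_pair_project_out_fst:
  fixes \<mu> :: "'a::euclidean_space measure" and \<nu> :: "'b::euclidean_space measure"
  assumes "prob_space \<nu>" "sets \<mu> = sets borel" "sets \<nu> = sets borel"
  shows "distr (\<mu> \<Otimes>\<^sub>M \<nu>) borel (project_out (u, 0)) = distr \<mu> borel (project_out u) \<Otimes>\<^sub>M \<nu>"
proof -
  interpret prob_space \<nu> by fact
  note [measurable_cong] = assms(2,3)
  have id: "distr \<nu> borel (\<lambda>x. x) = \<nu>"
    by (rule distr_id2) (simp add: assms)
  have "distr \<mu> borel (project_out u) \<Otimes>\<^sub>M distr \<nu> borel (\<lambda>x. x) =
      distr (\<mu> \<Otimes>\<^sub>M \<nu>) (borel \<Otimes>\<^sub>M borel) (\<lambda>(x, y). (project_out u x, y))"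
    by (rule pair_measure_distr) (simp_all add: id sigma_finite_measure_axioms, measurable)
  also have "(\<lambda>(x, y). (project_out u x, y)) = (project_out (u, 0 :: 'b))"
    by (auto simp: project_out_def fun_eq_iff)
  finally show ?thesis
    by (simp add: id borel_prod)
qed

lemma distr_pair_project_out_snd:
  fixes \<mu> :: "'a::euclidean_space measure" and \<nu> :: "'b::euclidean_space measure"
  assumes "prob_space \<nu>" "sets \<mu> = sets borel" "sets \<nu> = sets borel"
  shows "distr (\<mu> \<Otimes>\<^sub>M \<nu>) borel (project_out (0, u)) = \<mu> \<Otimes>\<^sub>M distr \<nu> borel (project_out u)"
proof -
  interpret prob_space \<nu> by fact
  note [measurable_cong] = assms(2,3)
  have id: "distr \<mu> borel (\<lambda>x. x) = \<mu>"
    by (rule distr_id2) (simp add: assms)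
  interpret \<nu>': prob_space "distr \<nu> borel (project_out u)"
    by (rule prob_space_distr) measurable
  have "distr \<mu> borel (\<lambda>x. x) \<Otimes>\<^sub>M distr \<nu> borel (project_out u) =
      distr (\<mu> \<Otimes>\<^sub>M \<nu>) (borel \<Otimes>\<^sub>M borel) (\<lambda>(x, y). (x, project_out u y))"
    by (rule pair_measure_distr) (simp_all add: \<nu>'.sigma_finite_measure_axioms, measurable)
  also have "(\<lambda>(x, y). (x, project_out u y)) = (project_out (0 :: 'a, u))"
    by (auto simp: project_out_def fun_eq_iff)
  finally show ?thesis
    by (simp add: id borel_prod)
qed

lemma W2_project_out_le:
  fixes Q :: "'a::euclidean_space measure"
  assumes Q: "prob_space Q" "sets Q = sets borel" and w: "norm w = 1"
    and r: "0 \<le> r" "(\<integral>\<^sup>+ x. ennreal ((w \<bullet> x)\<^sup>2) \<partial>Q) = ennreal r"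
  shows "W2 Q (distr Q borel (project_out w)) \<le> ennreal (sqrt r)"
proof -
  have "(norm (x - project_out w x))\<^sup>2 = (w \<bullet> x)\<^sup>2" for x
    using w by (simp add: project_out_def)
  then show ?thesis
    using W2_distr_le[OF Q measurable_project_out[of w]] r by (simp add: ennreal_sqrt_ennreal)
qed

text \<open>The set is the explicit form of the exceptional set. In both directions the relevant
  quantity is the second moment along a unit vector of one factor: at a minimal eigenvector of the
  given law it is the least eigenvalue, and at a kernel vector of the competitor it is at least
  that.\<close>

lemma W2_set_singular_second_moment:
  fixes \<mu> :: "(real ^ 'm) measure" and \<nu> :: "(real ^ 'n) measure"
  assumes \<mu>: "\<mu> \<in> P4" and \<nu>: "\<nu> \<in> P4"
  shows "W2_set (\<mu> \<Otimes>\<^sub>M \<nu>) {\<mu>' \<Otimes>\<^sub>M \<nu>' | \<mu>' \<nu>'. \<mu>' \<in> P4 \<and> \<nu>' \<in> P4 \<and>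
      (lambda_min (second_moment \<mu>') = 0 \<or> lambda_min (second_moment \<nu>') = 0)} =
    ennreal (min (sqrt (lambda_min (second_moment \<mu>))) (sqrt (lambda_min (second_moment \<nu>))))"
    (is "W2_set ?Q ?E = ennreal (min (sqrt ?l1) (sqrt ?l2))")
proof (rule antisym)
  interpret \<mu>: prob_space \<mu> using \<mu> by (rule P4_prob_space)
  interpret \<nu>: prob_space \<nu> using \<nu> by (rule P4_prob_space)
  interpret Q: pair_prob_space \<mu> \<nu> ..
  note [measurable_cong] = P4_sets[OF \<mu>] P4_sets[OF \<nu>]
  have prob: "prob_space ?Q"
    by (rule Q.prob_space_axioms)
  have sets: "sets ?Q = sets borel"
    unfolding borel_prod[symmetric] by (intro sets_pair_measure_cong P4_sets \<mu> \<nu>)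
  have fst: "(\<integral>\<^sup>+ z. ennreal (((u, 0) \<bullet> z)\<^sup>2) \<partial>?Q) = ennreal ((second_moment \<mu> *v u) \<bullet> u)" for u
    using nn_integral_pair_fst[OF \<nu>.prob_space_axioms, of "\<lambda>x. ennreal ((u \<bullet> x)\<^sup>2)" \<mu>]
    by (simp add: nn_integral_second_moment[OF \<mu>] inner_prod_def)
  have snd: "(\<integral>\<^sup>+ z. ennreal (((0, u) \<bullet> z)\<^sup>2) \<partial>?Q) = ennreal ((second_moment \<nu> *v u) \<bullet> u)" for u
    using nn_integral_pair_snd[OF \<mu>.prob_space_axioms \<nu>.prob_space_axioms, of "\<lambda>x. ennreal ((u \<bullet> x)\<^sup>2)"]
    by (simp add: nn_integral_second_moment[OF \<nu>] inner_prod_def)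
  show "W2_set ?Q ?E \<le> ennreal (min (sqrt ?l1) (sqrt ?l2))"
  proof (cases "?l1 \<le> ?l2")
    \<comment> \<open>The competitor is obtained by degenerating the factor with the smaller
      eigenvalue.\<close>
    case True
    obtain u where u: "norm u = 1" "second_moment \<mu> *v u = ?l1 *\<^sub>R u"
      by (rule lambda_min_eigenvector[OF transpose_second_moment[of \<mu>]])
    have "distr ?Q borel (project_out (u, 0)) \<in> ?E"
      using distr_pair_project_out_fst[OF \<nu>.prob_space_axioms P4_sets[OF \<mu>] P4_sets[OF \<nu>]]
        P4_project_out[OF \<mu> u(1)] lambda_min_project_out[OF \<mu> u(1)] \<nu> by blast
    then have "W2_set ?Q ?E \<le> W2 ?Q (distr ?Q borel (project_out (u, 0)))"
      unfolding W2_set_def by (rule INF_lower)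
    also have "\<dots> \<le> ennreal (sqrt ?l1)"
      by (rule W2_project_out_le[OF prob sets _ lambda_min_second_moment_nonneg[OF \<mu>]])
        (use u in \<open>simp_all add: fst norm_eq_1\<close>)
    finally show ?thesis
      using True by (simp add: min_absorb1)
  next
    case False
    obtain u where u: "norm u = 1" "second_moment \<nu> *v u = ?l2 *\<^sub>R u"
      by (rule lambda_min_eigenvector[OF transpose_second_moment[of \<nu>]])
    have "distr ?Q borel (project_out (0, u)) \<in> ?E"
      using distr_pair_project_out_snd[OF \<nu>.prob_space_axioms P4_sets[OF \<mu>] P4_sets[OF \<nu>]]
        P4_project_out[OF \<nu> u(1)] lambda_min_project_out[OF \<nu> u(1)] \<mu> by blast
    then have "W2_set ?Q ?E \<le> W2 ?Q (distr ?Q borel (project_out (0, u)))"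
      unfolding W2_set_def by (rule INF_lower)
    also have "\<dots> \<le> ennreal (sqrt ?l2)"
      by (rule W2_project_out_le[OF prob sets _ lambda_min_second_moment_nonneg[OF \<nu>]])
        (use u in \<open>simp_all add: snd norm_eq_1\<close>)
    finally show ?thesis
      using False by (simp add: min_absorb2)
  qed
  show "ennreal (min (sqrt ?l1) (sqrt ?l2)) \<le> W2_set ?Q ?E"
    unfolding W2_set_def
  proof (rule INF_greatest)
    fix Q' assume "Q' \<in> ?E"
    then obtain \<mu>' \<nu>' where Q': "Q' = \<mu>' \<Otimes>\<^sub>M \<nu>'" and \<mu>': "\<mu>' \<in> P4" and \<nu>': "\<nu>' \<in> P4"
      and sing: "lambda_min (second_moment \<mu>') = 0 \<or> lambda_min (second_moment \<nu>') = 0"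
      by blast
    have [measurable_cong]: "sets Q' = sets borel"
      unfolding Q' borel_prod[symmetric] by (intro sets_pair_measure_cong P4_sets \<mu>' \<nu>')
    note [measurable_cong] = P4_sets[OF \<mu>'] P4_sets[OF \<nu>']
    \<comment> \<open>A vanishing second moment along \<open>w\<close> means that the law is carried
      by the hyperplane orthogonal to \<open>w\<close>.\<close>
    have AE0: "AE z in Q'. w \<bullet> z = 0" if "(\<integral>\<^sup>+ z. ennreal ((w \<bullet> z)\<^sup>2) \<partial>Q') = 0" for w
    proof -
      have "AE z in Q'. ennreal ((w \<bullet> z)\<^sup>2) = 0"
        using that by (subst (asm) nn_integral_0_iff_AE) measurable
      then show ?thesis
        by simp
    qed
    from sing show "ennreal (min (sqrt ?l1) (sqrt ?l2)) \<le> W2 ?Q Q'"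
    proof
      assume "lambda_min (second_moment \<mu>') = 0"
      then obtain u where u: "norm u = 1" "second_moment \<mu>' *v u = 0"
        using lambda_min_eigenvector[OF transpose_second_moment[of \<mu>']] by (metis scaleR_zero_left)
      have "(\<integral>\<^sup>+ z. ennreal (((u, 0) \<bullet> z)\<^sup>2) \<partial>Q') = 0"
        using nn_integral_pair_fst[OF P4_prob_space[OF \<nu>'], of "\<lambda>x. ennreal ((u \<bullet> x)\<^sup>2)" \<mu>'] u(2)
        by (simp add: Q' nn_integral_second_moment[OF \<mu>'] inner_prod_def)
      then have "ennreal (sqrt ?l1) \<le> W2 ?Q Q'"
        by (intro W2_ge[of "(u, 0)"] AE0)
          (use u lambda_min_le_energy[OF transpose_second_moment, of \<mu> u] in \<open>simp_all add: fst ennreal_leI\<close>)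
      then show ?thesis
        by (rule order_trans[rotated]) (simp add: ennreal_leI)
    next
      assume "lambda_min (second_moment \<nu>') = 0"
      then obtain u where u: "norm u = 1" "second_moment \<nu>' *v u = 0"
        using lambda_min_eigenvector[OF transpose_second_moment[of \<nu>']] by (metis scaleR_zero_left)
      have "(\<integral>\<^sup>+ z. ennreal (((0, u) \<bullet> z)\<^sup>2) \<partial>Q') = 0"
        using nn_integral_pair_snd[OF P4_prob_space[OF \<mu>'] P4_prob_space[OF \<nu>'], of "\<lambda>x. ennreal ((u \<bullet> x)\<^sup>2)"] u(2)
        by (simp add: Q' nn_integral_second_moment[OF \<nu>'] inner_prod_def)
      then have "ennreal (sqrt ?l2) \<le> W2 ?Q Q'"
        by (intro W2_ge[of "(0, u)"] AE0)
          (use u lambda_min_le_energy[OF transpose_second_moment, of \<nu> u] in \<open>simp_all add: snd ennreal_leI\<close>)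
      then show ?thesis
        by (rule order_trans[rotated]) (simp add: ennreal_leI)
    qed
  qed
qed

section \<open>Bilinear sensing\<close>

text \<open>The population risk under feature laws \<open>\<mu>\<close> and \<open>\<nu>\<close> has this form, with \<open>c0\<close> half the noise
  variance.\<close>

locale bilinear_sensing =
  fixes \<mu> :: "(real ^ 'm) measure" and \<nu> :: "(real ^ 'n) measure"
    and \<beta>1 :: "real ^ 'm" and \<beta>2 :: "real ^ 'n"
    and f :: "real ^ 'n ^ 'm \<Rightarrow> real" and c0 :: real
    and M0 :: "real ^ 'n ^ 'm" and S1 :: "real ^ 'm ^ 'm" and S2 :: "real ^ 'n ^ 'n"
  assumes \<mu>: "\<mu> \<in> P4" and \<nu>: "\<nu> \<in> P4" and \<beta>1: "\<beta>1 \<noteq> 0" and \<beta>2: "\<beta>2 \<noteq> 0"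
    and f: "f M = c0 + (S1 ** (M - M0) ** S2) \<bullet> (M - M0) / 2"
    and M0_def: "M0 = outer_product \<beta>1 \<beta>2"
    and S1_def: "S1 = second_moment \<mu>" and S2_def: "S2 = second_moment \<nu>"
begin

lemma S1_sym: "transpose S1 = S1" and S2_sym: "transpose S2 = S2"
  by (simp_all add: S1_def S2_def transpose_second_moment)

lemma lambda_min_nonneg: "0 \<le> lambda_min S1" "0 \<le> lambda_min S2"
  unfolding S1_def S2_def by (rule lambda_min_second_moment_nonneg[OF \<mu>] lambda_min_second_moment_nonneg[OF \<nu>])+

lemma energy_outer_product:
  "(S1 ** outer_product x y ** S2) \<bullet> outer_product x y = ((S1 *v x) \<bullet> x) * ((S2 *v y) \<bullet> y)"
proof -
  have "y v* S2 = S2 *v y"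
    by (metis S2_sym transpose_matrix_vector)
  then show ?thesis
    by (simp add: sandwich_outer_product inner_outer_outer)
qed

text \<open>Only the product of the factors matters, so the length of \<open>\<beta>1\<close> is
  moved into the second factor to meet the normalization of the locale.\<close>

lemma rank_one_quadratic:
  assumes "0 < lambda_min S1" "0 < lambda_min S2"
  shows "rank_one_quadratic (\<lambda>X. S1 ** X ** S2) (\<beta>1 /\<^sub>R norm \<beta>1) (norm \<beta>1 *\<^sub>R \<beta>2) f c0
    (lambda_min S1 * lambda_min S2) M0"
proof (rule rank_one_quadratic.intro)
  show "linear (\<lambda>X. S1 ** X ** S2)"
    by (rule linear_sandwich)
  show "(S1 ** X ** S2) \<bullet> Y = X \<bullet> (S1 ** Y ** S2)" for X Y
    by (rule sandwich_selfadjoint[OF S1_sym S2_sym])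
  show "lambda_min S1 * lambda_min S2 * (norm X)\<^sup>2 \<le> (S1 ** X ** S2) \<bullet> X" for X
    unfolding S1_def S2_def by (rule second_moment_sandwich_bounds[OF \<mu> \<nu>])
  show "M0 = outer_product (\<beta>1 /\<^sub>R norm \<beta>1) (norm \<beta>1 *\<^sub>R \<beta>2)"
    using \<beta>1 by (simp add: M0_def outer_product_simps)
qed (use assms \<beta>1 \<beta>2 f in simp_all)

lemma singular_not_tilt_stable:
  assumes "lambda_min S1 = 0 \<or> lambda_min S2 = 0"
  shows "\<not> tilt_stable_minimizer rank_one_matrices f M0"
proof -
  have flat: "f (M0 + s *\<^sub>R D) \<le> f M0" if "(S1 ** D ** S2) \<bullet> D = 0" for s D
  proof -
    have "S1 ** (s *\<^sub>R D) ** S2 = s *\<^sub>R (S1 ** D ** S2)"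
      by (rule linear_scale[OF linear_sandwich])
    moreover have "S1 ** 0 ** S2 = (0 :: real ^ 'n ^ 'm)"
      by (rule linear_0[OF linear_sandwich])
    ultimately show ?thesis
      using that by (simp add: f)
  qed
  from assms show ?thesis
  proof
    assume "lambda_min S1 = 0"
    then obtain u where u: "norm u = 1" "S1 *v u = 0"
      using lambda_min_eigenvector[OF S1_sym] by (metis scaleR_zero_left)
    show ?thesis
    proof (rule not_tilt_stable_minimizerI)
      show "outer_product u \<beta>2 \<noteq> 0"
        using u \<beta>2 by auto
      show "f (M0 + s *\<^sub>R outer_product u \<beta>2) \<le> f M0" for s
        by (rule flat) (simp add: energy_outer_product u)
      show "\<forall>\<^sub>F s in at 0. M0 + s *\<^sub>R outer_product u \<beta>2 \<in> rank_one_matrices"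
        unfolding M0_def by (rule eventually_rank_one_left[OF \<beta>1 \<beta>2])
    qed
  next
    assume "lambda_min S2 = 0"
    then obtain v where v: "norm v = 1" "S2 *v v = 0"
      using lambda_min_eigenvector[OF S2_sym] by (metis scaleR_zero_left)
    show ?thesis
    proof (rule not_tilt_stable_minimizerI)
      show "outer_product \<beta>1 v \<noteq> 0"
        using v \<beta>1 by auto
      show "f (M0 + s *\<^sub>R outer_product \<beta>1 v) \<le> f M0" for s
        by (rule flat) (simp add: energy_outer_product v)
      show "\<forall>\<^sub>F s in at 0. M0 + s *\<^sub>R outer_product \<beta>1 v \<in> rank_one_matrices"
        unfolding M0_def by (rule eventually_rank_one_right[OF \<beta>1 \<beta>2])
    qed
  qed
qed

lemma tilt_stable_iff:
  "tilt_stable_minimizer rank_one_matrices f M0 \<longleftrightarrow> lambda_min S1 \<noteq> 0 \<and> lambda_min S2 \<noteq> 0"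
  using singular_not_tilt_stable lambda_min_nonneg
    rank_one_quadratic.tilt_stable[OF rank_one_quadratic] by fastforce

definition "gamma1 = (S1 *v (\<beta>1 /\<^sub>R norm \<beta>1)) \<bullet> (\<beta>1 /\<^sub>R norm \<beta>1)"
definition "gamma2 = (S2 *v (\<beta>2 /\<^sub>R norm \<beta>2)) \<bullet> (\<beta>2 /\<^sub>R norm \<beta>2)"

lemma gamma_pos:
  assumes "0 < lambda_min S1" "0 < lambda_min S2"
  shows "0 < gamma1" "0 < gamma2"
proof -
  show "0 < gamma1"
    using lambda_min_le_energy[OF S1_sym, of "\<beta>1 /\<^sub>R norm \<beta>1"] assms \<beta>1 by (simp add: gamma1_def)
  show "0 < gamma2"
    using lambda_min_le_energy[OF S2_sym, of "\<beta>2 /\<^sub>R norm \<beta>2"] assms \<beta>2 by (simp add: gamma2_def)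
qed

text \<open>\<open>gamma2\<close> is a Rayleigh quotient and hence is unaffected by the rescaling of
  \<open>\<beta>2\<close>.\<close>

lemma gamma2_scaled: "(S2 *v (norm \<beta>1 *\<^sub>R \<beta>2)) \<bullet> (norm \<beta>1 *\<^sub>R \<beta>2) = gamma2 * (norm (norm \<beta>1 *\<^sub>R \<beta>2))\<^sup>2"
  using \<beta>2 by (simp add: gamma2_def matrix_vector_mult_scaleR power2_eq_square field_simps)

text \<open>The number \<open>q\<close> is at once a lower bound for the Rayleigh quotients on both
  tangent families and the value attained by a minimal eigenvector in one of them, so the same
  \<open>q\<close> serves both estimates.\<close>

theorem REG_bounds:
  assumes pos: "0 < lambda_min S1" "0 < lambda_min S2"
  defines "q \<equiv> min (gamma2 * lambda_min S1) (gamma1 * lambda_min S2)"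
    and "C \<equiv> (cond_number S1 * cond_number S2 + 1) / 2"
  shows "\<exists>r. REG rank_one_matrices f M0 = ennreal r \<and> 1 / q \<le> r \<and> r \<le> C / q"
proof -
  let ?A = "\<lambda>X :: real ^ 'n ^ 'm. S1 ** X ** S2"
  let ?b1 = "\<beta>1 /\<^sub>R norm \<beta>1" and ?b2 = "norm \<beta>1 *\<^sub>R \<beta>2"
  interpret R: rank_one_quadratic ?A ?b1 ?b2 f c0 "lambda_min S1 * lambda_min S2" M0
    by (rule rank_one_quadratic[OF pos])
  obtain L where L: "R.is_tilt_derivative L" "REG rank_one_matrices f M0 = ennreal (onorm L)"
    using R.REG_eq by blast
  have b1: "norm ?b1 = 1" and b2: "?b2 \<noteq> 0"
    using \<beta>1 \<beta>2 by simp_all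
  have q: "0 < q"
    using gamma_pos pos by (simp add: q_def)
  have left: "?A (outer_product x ?b2) \<bullet> outer_product x ?b2 = gamma2 * ((S1 *v x) \<bullet> x) * (norm ?b2)\<^sup>2" for x
    unfolding energy_outer_product gamma2_scaled by simp
  have right: "?A (outer_product ?b1 y) \<bullet> outer_product ?b1 y = gamma1 * ((S2 *v y) \<bullet> y)" for y
    unfolding energy_outer_product gamma1_def ..
  have "1 / q \<le> onorm L"
  proof (cases "gamma2 * lambda_min S1 \<le> gamma1 * lambda_min S2")
    case True
    obtain u where u: "norm u = 1" "S1 *v u = lambda_min S1 *\<^sub>R u"
      by (rule lambda_min_eigenvector[OF S1_sym])
    show ?thesis
    proof (rule R.onorm_tilt_derivative_ge[OF L(1) disjI1[OF refl] _ q])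
      show "outer_product u ?b2 \<noteq> 0"
        using u(1) b2 by auto
      show "?A (outer_product u ?b2) \<bullet> outer_product u ?b2 \<le> q * (norm (outer_product u ?b2))\<^sup>2"
        unfolding left norm_outer_product q_def using True u norm_eq_1[of u] by (simp add: min_absorb1)
    qed
  next
    case False
    obtain v where v: "norm v = 1" "S2 *v v = lambda_min S2 *\<^sub>R v"
      by (rule lambda_min_eigenvector[OF S2_sym])
    show ?thesis
    proof (rule R.onorm_tilt_derivative_ge[OF L(1) disjI2[OF refl] _ q])
      show "outer_product ?b1 v \<noteq> 0"
        using v(1) b1 by auto
      show "?A (outer_product ?b1 v) \<bullet> outer_product ?b1 v \<le> q * (norm (outer_product ?b1 v))\<^sup>2"
        unfolding right norm_outer_product b1 q_def using False v norm_eq_1[of v] by (simp add: min_absorb2)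
    qed
  qed
  moreover have "onorm L \<le> (lambda_max S1 * lambda_max S2 / (lambda_min S1 * lambda_min S2) + 1) / 2 / q"
  proof (rule R.onorm_tilt_derivative_le[OF L(1) _ q])
    show "?A X \<bullet> X \<le> lambda_max S1 * lambda_max S2 * (norm X)\<^sup>2" for X
      unfolding S1_def S2_def by (rule second_moment_sandwich_bounds[OF \<mu> \<nu>])
    show "q * (norm (outer_product x ?b2))\<^sup>2 \<le> ?A (outer_product x ?b2) \<bullet> outer_product x ?b2" for x
    proof -
      have "q * (norm x)\<^sup>2 \<le> gamma2 * (lambda_min S1 * (norm x)\<^sup>2)"
        unfolding mult.assoc[symmetric] by (intro mult_right_mono) (simp_all add: q_def)
      also have "\<dots> \<le> gamma2 * ((S1 *v x) \<bullet> x)"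
        using gamma_pos[OF pos] by (intro mult_left_mono lambda_min_le_energy S1_sym) simp
      finally have "q * (norm x)\<^sup>2 * (norm ?b2)\<^sup>2 \<le> gamma2 * ((S1 *v x) \<bullet> x) * (norm ?b2)\<^sup>2"
        by (rule mult_right_mono) simp
      then show ?thesis
        unfolding left norm_outer_product power_mult_distrib mult.assoc .
    qed
    show "q * (norm (outer_product ?b1 y))\<^sup>2 \<le> ?A (outer_product ?b1 y) \<bullet> outer_product ?b1 y" for y
    proof -
      have "q * (norm y)\<^sup>2 \<le> gamma1 * (lambda_min S2 * (norm y)\<^sup>2)"
        unfolding mult.assoc[symmetric] by (intro mult_right_mono) (simp_all add: q_def)
      also have "\<dots> \<le> gamma1 * ((S2 *v y) \<bullet> y)"
        using gamma_pos[OF pos] by (intro mult_left_mono lambda_min_le_energy S2_sym) simp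
      finally show ?thesis
        unfolding right norm_outer_product b1 by simp
    qed
  qed
  then have "onorm L \<le> C / q"
    by (simp add: C_def cond_number_def)
  ultimately show ?thesis
    using L(2) by blast
qed

end

section \<open>Random variables, product laws and the sensing problem\<close>

lemma distr_pair_indep_rv:
  fixes X :: "'w \<Rightarrow> 'a::second_countable_topology" and Y :: "'w \<Rightarrow> 'b::second_countable_topology"
  assumes "prob_space P" and ind: "indep_rv P X Y"
  shows "distr P borel (\<lambda>\<omega>. (X \<omega>, Y \<omega>)) = distr P borel X \<Otimes>\<^sub>M distr P borel Y"
proof -
  interpret prob_space P by fact
  have X [measurable]: "X \<in> borel_measurable P" and Y [measurable]: "Y \<in> borel_measurable P"
    and set: "indep_set {X -` A \<inter> space P | A. A \<in> sets borel} {Y -` B \<inter> space P | B. B \<in> sets borel}"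
    using ind by (simp_all add: indep_rv_def)
  interpret X: prob_space "distr P borel X" by (rule prob_space_distr) measurable
  interpret Y: prob_space "distr P borel Y" by (rule prob_space_distr) measurable
  have XY: "(\<lambda>\<omega>. (X \<omega>, Y \<omega>)) \<in> measurable P (borel \<Otimes>\<^sub>M borel)"
    by measurable
  have "distr P borel X \<Otimes>\<^sub>M distr P borel Y = distr P (borel \<Otimes>\<^sub>M borel) (\<lambda>\<omega>. (X \<omega>, Y \<omega>))"
  proof (rule pair_measure_eqI)
    show "sigma_finite_measure (distr P borel X)" "sigma_finite_measure (distr P borel Y)"
      by (rule X.sigma_finite_measure_axioms Y.sigma_finite_measure_axioms)+
    fix A B assume "A \<in> sets (distr P borel X)" "B \<in> sets (distr P borel Y)"
    then have AB: "A \<in> sets borel" "B \<in> sets borel"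
      by simp_all
    have "emeasure (distr P (borel \<Otimes>\<^sub>M borel) (\<lambda>\<omega>. (X \<omega>, Y \<omega>))) (A \<times> B) =
        emeasure P ((X -` A \<inter> space P) \<inter> (Y -` B \<inter> space P))"
      using AB XY by (subst emeasure_distr) (auto intro!: arg_cong[where f = "emeasure P"])
    also have "\<dots> = emeasure P (X -` A \<inter> space P) * emeasure P (Y -` B \<inter> space P)"
    proof -
      have "prob ((X -` A \<inter> space P) \<inter> (Y -` B \<inter> space P)) =
          prob (X -` A \<inter> space P) * prob (Y -` B \<inter> space P)"
        using AB by (intro indep_setD[OF set]) auto
      then show ?thesis
        by (simp add: emeasure_eq_measure ennreal_mult)
    qed
    finally show "emeasure (distr P borel X) A * emeasure (distr P borel Y) B =
        emeasure (distr P (borel \<Otimes>\<^sub>M borel) (\<lambda>\<omega>. (X \<omega>, Y \<omega>))) (A \<times> B)"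
      using AB by (simp add: emeasure_distr)
  qed simp
  then show ?thesis
    by (simp add: borel_prod)
qed

theorem theorem5p6:
  fixes P :: "'w measure"
    and X1 :: "'w \<Rightarrow> real ^ 'm" and X2 :: "'w \<Rightarrow> real ^ 'n" and noise :: "'w \<Rightarrow> real"
    and \<beta>1 :: "real ^ 'm" and \<beta>2 :: "real ^ 'n"
  defines "M\<^sub>0 \<equiv> outer_product \<beta>1 \<beta>2"
  defines "Y \<equiv> (\<lambda>\<omega>. X1 \<omega> \<bullet> (M\<^sub>0 *v X2 \<omega>) + noise \<omega>)"
  defines "D \<equiv> distr P borel (\<lambda>\<omega>. ((X1 \<omega>, X2 \<omega>), Y \<omega>))"
  defines "K \<equiv> (\<lambda>(x1, x2). distr P borel (\<lambda>\<omega>. x1 \<bullet> (M\<^sub>0 *v x2) + noise \<omega>))"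
  defines "\<Sigma>1 \<equiv> second_moment (law_x1 D)" and "\<Sigma>2 \<equiv> second_moment (law_x2 D)"
  defines "\<gamma>1 \<equiv> (\<Sigma>1 *v (\<beta>1 /\<^sub>R norm \<beta>1)) \<bullet> (\<beta>1 /\<^sub>R norm \<beta>1)"
    and "\<gamma>2 \<equiv> (\<Sigma>2 *v (\<beta>2 /\<^sub>R norm \<beta>2)) \<bullet> (\<beta>2 /\<^sub>R norm \<beta>2)"
  defines "C \<equiv> (cond_number \<Sigma>1 * cond_number \<Sigma>2 + 1) / 2"
  defines "\<rho> \<equiv> min (lambda_min \<Sigma>1) (lambda_min \<Sigma>2) /
               min (\<gamma>2 * lambda_min \<Sigma>1) (\<gamma>1 * lambda_min \<Sigma>2)"
  assumes "prob_space P"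
    and "\<beta>1 \<noteq> 0" and "\<beta>2 \<noteq> 0"
    and "X1 \<in> borel_measurable P" and "X2 \<in> borel_measurable P" and "noise \<in> borel_measurable P"
    and "distr P borel X1 \<in> P4" and "distr P borel X2 \<in> P4"
    and "indep_rv P X1 X2"
    and "indep_rv P (\<lambda>\<omega>. (X1 \<omega>, X2 \<omega>)) noise"
    and "integrable P noise" and "(LINT \<omega>|P. noise \<omega>) = 0"
    and "integrable P (\<lambda>\<omega>. (noise \<omega>)\<^sup>2)"
  shows "RSE D K M\<^sub>0 = ennreal (min (sqrt (lambda_min \<Sigma>1)) (sqrt (lambda_min \<Sigma>2))) \<and>
    (law_x1 D \<Otimes>\<^sub>M law_x2 D \<in> permissible - exceptional K M\<^sub>0 \<longrightarrow>
       ennreal \<rho> \<le> (RSE D K M\<^sub>0)\<^sup>2 * REG_bilinear D M\<^sub>0 \<and>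
       (RSE D K M\<^sub>0)\<^sup>2 * REG_bilinear D M\<^sub>0 \<le> ennreal (C * \<rho>))"
proof -
  note P = \<open>prob_space P\<close>
  interpret prob_space P by (rule P)
  note [measurable] = \<open>X1 \<in> borel_measurable P\<close> \<open>X2 \<in> borel_measurable P\<close> \<open>noise \<in> borel_measurable P\<close>
  define \<mu> where "\<mu> = distr P borel X1"
  define \<nu> where "\<nu> = distr P borel X2"
  define N where "N = distr P borel noise"
  have \<mu>: "\<mu> \<in> P4" and \<nu>: "\<nu> \<in> P4"
    using assms by (simp_all add: \<mu>_def \<nu>_def)
  have N: "prob_space N" "sets N = sets borel"
    unfolding N_def by (auto intro!: prob_space_distr)
  have N_moments: "integrable N (\<lambda>n. n)" "(LINT n|N. n) = 0" "integrable N (\<lambda>n. n\<^sup>2)"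
    using \<open>integrable P noise\<close> \<open>(LINT \<omega>|P. noise \<omega>) = 0\<close> \<open>integrable P (\<lambda>\<omega>. (noise \<omega>)\<^sup>2)\<close>
    unfolding N_def by (simp_all add: integrable_distr_eq integral_distr)
  have [measurable]: "(\<lambda>x. X *v x) \<in> borel_measurable borel" for X :: "real ^ 'n ^ 'm"
    by (intro borel_measurable_continuous_onI linear_continuous_on matrix_vector_mul_bounded_linear)
  define g where "g x = fst x \<bullet> (M\<^sub>0 *v snd x)" for x :: "(real ^ 'm) \<times> (real ^ 'n)"
  have g [measurable]: "g \<in> borel_measurable borel"
    unfolding g_def[abs_def] borel_prod[symmetric] by measurable
  let ?F = "\<lambda>z. (fst z, fst (fst z) \<bullet> (M\<^sub>0 *v snd (fst z)) + snd z)"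
  have F: "?F \<in> measurable (borel \<Otimes>\<^sub>M borel) borel"
    unfolding borel_prod[symmetric] by measurable
  have Y [measurable]: "Y \<in> borel_measurable P"
    unfolding Y_def by measurable
  have X12 [measurable]: "(\<lambda>\<omega>. (X1 \<omega>, X2 \<omega>)) \<in> borel_measurable P"
    unfolding borel_prod[symmetric] by measurable
  have D_meas: "(\<lambda>\<omega>. ((X1 \<omega>, X2 \<omega>), Y \<omega>)) \<in> borel_measurable P"
    unfolding borel_prod[symmetric] by measurable
  have "distr P borel (\<lambda>\<omega>. (X1 \<omega>, X2 \<omega>)) = \<mu> \<Otimes>\<^sub>M \<nu>"
    unfolding \<mu>_def \<nu>_def by (rule distr_pair_indep_rv[OF P \<open>indep_rv P X1 X2\<close>])
  then have joint: "distr P borel (\<lambda>\<omega>. ((X1 \<omega>, X2 \<omega>), noise \<omega>)) = (\<mu> \<Otimes>\<^sub>M \<nu>) \<Otimes>\<^sub>M N"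
    using distr_pair_indep_rv[OF P \<open>indep_rv P (\<lambda>\<omega>. (X1 \<omega>, X2 \<omega>)) noise\<close>] by (simp add: N_def)
  have D: "D = distr ((\<mu> \<Otimes>\<^sub>M \<nu>) \<Otimes>\<^sub>M N) borel ?F"
  proof -
    have "(\<lambda>\<omega>. ((X1 \<omega>, X2 \<omega>), noise \<omega>)) \<in> borel_measurable P"
      unfolding borel_prod[symmetric] by measurable
    moreover have "?F \<in> measurable borel borel"
      using F by (simp add: borel_prod)
    ultimately show ?thesis
      unfolding joint[symmetric] by (simp add: distr_distr o_def D_def Y_def)
  qed
  have fst_fst: "(\<lambda>z. fst (fst z)) \<in> measurable (borel :: (((real ^ 'm) \<times> (real ^ 'n)) \<times> real) measure) borel"
    and snd_fst: "(\<lambda>z. snd (fst z)) \<in> measurable (borel :: (((real ^ 'm) \<times> (real ^ 'n)) \<times> real) measure) borel"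
    unfolding borel_prod[symmetric] by measurable
  have law1: "law_x1 D = \<mu>" and law2: "law_x2 D = \<nu>"
    unfolding law_x1_def law_x2_def D_def \<mu>_def \<nu>_def
    using D_meas fst_fst snd_fst by (simp_all add: distr_distr o_def)
  \<comment> \<open>The conditional law is the noise law translated by the noiseless response. It is
    given at every feature value, so it remains meaningful under feature laws of any
    support.\<close>
  have K: "K = (\<lambda>x. distr N borel (\<lambda>n. g x + n))"
    by (auto simp: K_def N_def g_def fun_eq_iff distr_distr o_def)
  \<comment> \<open>The feature laws are arbitrary here because the exceptional set varies them
    while the kernel, and with it \<open>N\<close>, stays fixed.\<close>
  have sensing: "bilinear_sensing \<mu>' \<nu>' \<beta>1 \<beta>2
      (bilinear_risk (distr ((\<mu>' \<Otimes>\<^sub>M \<nu>') \<Otimes>\<^sub>M N) borel ?F)) ((LINT n|N. n\<^sup>2) / 2)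
      M\<^sub>0 (second_moment \<mu>') (second_moment \<nu>')"
    if "\<mu>' \<in> P4" "\<nu>' \<in> P4" for \<mu>' \<nu>'
    using that \<open>\<beta>1 \<noteq> 0\<close> \<open>\<beta>2 \<noteq> 0\<close>
    by unfold_locales (simp_all add: bilinear_risk_additive_noise N N_moments M\<^sub>0_def)
  have joint_law: "joint_law (\<mu>' \<Otimes>\<^sub>M \<nu>') K = distr ((\<mu>' \<Otimes>\<^sub>M \<nu>') \<Otimes>\<^sub>M N) borel ?F"
    if "\<mu>' \<in> P4" "\<nu>' \<in> P4" for \<mu>' \<nu>'
  proof -
    interpret \<mu>': prob_space \<mu>' using that(1) by (rule P4_prob_space)
    interpret \<nu>': prob_space \<nu>' using that(2) by (rule P4_prob_space)
    interpret Q: pair_prob_space \<mu>' \<nu>' ..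
    have "sets (\<mu>' \<Otimes>\<^sub>M \<nu>') = sets borel"
      unfolding borel_prod[symmetric] by (intro sets_pair_measure_cong P4_sets that)
    then show ?thesis
      unfolding K using joint_law_additive_noise[OF Q.prob_space_axioms _ N g] by (simp add: g_def)
  qed
  have stable: "tilt_stable_minimizer rank_one_matrices (bilinear_risk (joint_law (\<mu>' \<Otimes>\<^sub>M \<nu>') K)) M\<^sub>0 \<longleftrightarrow>
      lambda_min (second_moment \<mu>') \<noteq> 0 \<and> lambda_min (second_moment \<nu>') \<noteq> 0"
    if "\<mu>' \<in> P4" "\<nu>' \<in> P4" for \<mu>' \<nu>'
    unfolding joint_law[OF that] by (rule bilinear_sensing.tilt_stable_iff[OF sensing[OF that]])
  have "exceptional K M\<^sub>0 = {\<mu>' \<Otimes>\<^sub>M \<nu>' | \<mu>' \<nu>'. \<mu>' \<in> P4 \<and> \<nu>' \<in> P4 \<and>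
      (lambda_min (second_moment \<mu>') = 0 \<or> lambda_min (second_moment \<nu>') = 0)}"
    unfolding exceptional_def permissible_def using stable by blast
  then have RSE: "RSE D K M\<^sub>0 = ennreal (min (sqrt (lambda_min \<Sigma>1)) (sqrt (lambda_min \<Sigma>2)))"
    unfolding RSE_def \<Sigma>1_def \<Sigma>2_def law1 law2 by (simp only: W2_set_singular_second_moment[OF \<mu> \<nu>])
  interpret B: bilinear_sensing \<mu> \<nu> \<beta>1 \<beta>2 "bilinear_risk D" "(LINT n|N. n\<^sup>2) / 2" M\<^sub>0 \<Sigma>1 \<Sigma>2
    using sensing[OF \<mu> \<nu>] unfolding D \<Sigma>1_def \<Sigma>2_def law1[unfolded D] law2[unfolded D] .
  have "ennreal \<rho> \<le> (RSE D K M\<^sub>0)\<^sup>2 * REG_bilinear D M\<^sub>0 \<and>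
       (RSE D K M\<^sub>0)\<^sup>2 * REG_bilinear D M\<^sub>0 \<le> ennreal (C * \<rho>)"
    if "law_x1 D \<Otimes>\<^sub>M law_x2 D \<in> permissible - exceptional K M\<^sub>0"
  proof -
    have "joint_law (\<mu> \<Otimes>\<^sub>M \<nu>) K = D"
      unfolding D by (rule joint_law[OF \<mu> \<nu>])
    then have "tilt_stable_minimizer rank_one_matrices (bilinear_risk D) M\<^sub>0"
      using that unfolding law1 law2 exceptional_def by simp
    \<comment> \<open>Lying outside the exceptional set means tilt stability, which excludes zero
      eigenvalues; nonnegativity of second moments does the rest.\<close>
    then have pos: "0 < lambda_min \<Sigma>1" "0 < lambda_min \<Sigma>2"
      using B.tilt_stable_iff B.lambda_min_nonneg by simp_all
    define q where "q = min (\<gamma>2 * lambda_min \<Sigma>1) (\<gamma>1 * lambda_min \<Sigma>2)"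
    define m where "m = min (lambda_min \<Sigma>1) (lambda_min \<Sigma>2)"
    have gamma: "B.gamma1 = \<gamma>1" "B.gamma2 = \<gamma>2"
      by (simp_all add: B.gamma1_def B.gamma2_def \<gamma>1_def \<gamma>2_def)
    obtain r where r: "REG_bilinear D M\<^sub>0 = ennreal r" "1 / q \<le> r" "r \<le> C / q"
      using B.REG_bounds[OF pos] unfolding REG_bilinear_def q_def C_def gamma by blast
    have "0 < q" "0 < m"
      using B.gamma_pos[OF pos] pos by (simp_all add: q_def m_def gamma)
    then have "0 \<le> r"
      using r(2) by (meson divide_nonneg_pos order_trans zero_le_one)
    \<comment> \<open>As the square root is monotone, the squared \<open>RSE\<close> is the smaller
      eigenvalue \<open>m\<close>, and the bounds on \<open>REG\<close> only need to be multiplied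
      by it.\<close>
    have "min (sqrt (lambda_min \<Sigma>1)) (sqrt (lambda_min \<Sigma>2)) = sqrt m"
      by (auto simp: m_def min_def)
    then have "(RSE D K M\<^sub>0)\<^sup>2 * REG_bilinear D M\<^sub>0 = ennreal (m * r)"
      using \<open>0 < m\<close> \<open>0 \<le> r\<close> by (simp add: RSE r(1) ennreal_power ennreal_mult)
    moreover have "\<rho> = m / q"
      by (simp add: \<rho>_def m_def q_def)
    moreover have "m / q \<le> m * r" "m * r \<le> C * (m / q)"
      using mult_left_mono[OF r(2), of m] mult_left_mono[OF r(3), of m] \<open>0 < m\<close>
      by (simp_all add: mult_ac)
    ultimately show ?thesis
      by (simp add: ennreal_leI)
  qed
  with RSE show ?thesis
    by blast
qed

end
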